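(* Every $\mathsf{RQCD}$ space satisfies the local Sobolev-to-Lipschitz property. That is: let $(X,d,m)$ be an infinitesimally Hilbertian geodesic Monge space satisfying $\mathsf{QCD}(Q,K,N)$ for some $Q\ge1$, $K\in\mathbb R$, $N\in(1,\infty)$. Then every $f\in W^{1,2}_{\mathrm{loc}}\cap L^\infty(m)$ with $|\mathrm Df|_w\le1$ $m$-a.e. coincides $m$-a.e. with a Lipschitz function $\hat f:X\to\mathbb R$ with global Lipschitz constant at most $1$.
   Context: A metric measure space $(X,d,m)$ is a complete separable metric space $(X,d)$ with an atomless Borel measure $m$ which is finite on bounded sets and has full topological support. It is geodesic if any two points are joined by a constant-speed geodesic. $\mathscr P_2(X)$ is the set of Borel probability measures with finite second moment, with the $L^2$-Wasserstein distance $W_2$; $\mathscr P^m_c(X)$ is the set of compactly supported Borel probability measures absolutely continuous w.r.t. $m$. Let $I=[0,1]$, let $\mathrm{Geo}(X,d)$ be the set of constant-speed geodesics $\gamma:I\to X$, i.e. $d(\gamma_s,\gamma_t)=|s-t|\,d(\gamma_0,\gamma_1)$, and let $\mathrm{ev}_t(\gamma)=\gamma_t$. $\mathrm{OptGeo}(\mu_0,\mu_1)$ is the set of Borel probability measures $\pi$ on $\mathcal C(I;X)$ concentrated on $\mathrm{Geo}(X,d)$ with $(\mathrm{ev}_i)_\sharp\pi=\mu_i$, $i=0,1$, and $W_2(\mu_0,\mu_1)^2=\int\int_I|\dot\gamma|_t^2\,dt\,d\pi(\gamma)$. Monge space: for every $\mu_0,\mu_1\in\mathscr P_2(X)$ with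 $\mu_0\ll m$: (a) there is a unique $\pi\in\mathrm{OptGeo}(\mu_0,\mu_1)$; (b) $\pi=T_\sharp\mu_0$ for some map $T:X\to\mathrm{Geo}(X,d)$; (c) $\mu_t:=(\mathrm{ev}_t)_\sharp\pi\ll m$ for all $t\in[0,1)$. Write $\rho_t=d\mu_t/dm$. Distortion coefficients: for $K\in\mathbb R$, $N\in(1,\infty)$, $t\in(0,1)$, $\theta\ge0$, put $\tau^{(t)}_{K,N}(\theta)=t^{1/N}\big(\sigma^{(t)}_{K,N-1}(\theta)\big)^{1-1/N}$, where, with $\kappa=K/(N-1)$, $\sigma^{(t)}_{K,N-1}(\theta)=\sin(t\theta\sqrt{\kappa})/\sin(\theta\sqrt{\kappa})$ if $K>0$ and $0<\theta<\pi/\sqrt\kappa$, $=+\infty$ if $K>0$ and $\theta\ge\pi/\sqrt\kappa$, $=t$ if $K=0$ or $\theta=0$, and $=\sinh(t\theta\sqrt{-\kappa})/\sinh(\theta\sqrt{-\kappa})$ if $K<0$ and $\theta>0$. A geodesic Monge space satisfies $\mathsf{QCD}(Q,K,N)$ if for every $\mu_0,\mu_1\in\mathscr P^m_c(X)$, with $\pi$ the unique element of $\mathrm{OptGeo}(\mu_0,\mu_1)$, $$\rho_t^{-1/N}(\gamma_t)\ge Q^{-1/N}\Big(\tau^{(1-t)}_{K,N}(d(\gamma_0,\gamma_1))\,\rho_0^{-1/N}(\gamma_0)+\tau^{(t)}_{K,N}(d(\gamma_0,\gamma_1))\,\rho_1^{-1/N}(\gamma_1)\Big)$$ for every $t\in(0,1)$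 and $\pi$-a.e. $\gamma$. Cheeger energy: for Lipschitz $f$ the slope is $|\mathrm Df|(x)=\limsup_{y\to x}|f(y)-f(x)|/d(x,y)$ ($0$ if $x$ is isolated). $\mathrm{Lip}_{bs}(d)$ is the space of Lipschitz functions with bounded support. $\mathsf{Ch}(f)=\inf\{\liminf_n\int_X|\mathrm Df_n|^2\,dm: f_n\in\mathrm{Lip}_{bs}(d),\ f_n\to f\text{ in }L^2(m)\}$ ($\inf\varnothing=+\infty$), and $W^{1,2}=\{f\in L^2(m):\mathsf{Ch}(f)<\infty\}$. For $f\in W^{1,2}$, $|\mathrm Df|_w\in L^2(m)$ is the weak minimal upper gradient: the element of minimal $L^2(m)$-norm among all weak $L^2(m)$-limits of $|\mathrm Df_n|$ with $f_n\in\mathrm{Lip}_{bs}(d)$, $f_n\to f$ in $L^2(m)$; one has $\mathsf{Ch}(f)=\int|\mathrm Df|_w^2\,dm$. The space is infinitesimally Hilbertian if $\mathsf{Ch}$ is a quadratic functional. $W^{1,2}_{\mathrm{loc}}$ is the space of ($m$-classes of) measurable functions $f$ such that for each relatively compact open $G\subset X$ there is $f_G\in W^{1,2}$ with $f=f_G$ $m$-a.e. on $G$; by locality $|\mathrm Df|_w$ extends to $W^{1,2}_{\mathrm{loc}}$ via $|\mathrm Df|_w=|\mathrm Df_G|_w$ $m$-a.e. on $G$. *)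

theory Defs
  imports "HOL-Analysis.Analysis" "HOL-Probability.Probability_Measure"
begin

text \<open>
  Metric spaces are types of class \<open>polish_space\<close>, i.e. complete metric spaces (with their metric
  \<open>dist\<close>) whose topology is second countable, equivalently separable.  Borel measures on such a
  space are measures whose \<open>\<sigma>\<close>-algebra is \<open>sets borel\<close>.  Elements of \<open>L\<^sup>2(m)\<close> and of the Sobolev
  classes are represented by measurable functions, without passing to \<open>m\<close>-classes.
\<close>

section \<open>Curves on the unit interval\<close>

typedef unit_interval = "{0..1::real}"
  by (rule exI[of _ 0]) simp

setup_lifting type_definition_unit_interval

instantiation unit_interval :: metric_space
begin

lift_definition dist_unit_interval :: "unit_interval \<Rightarrow> unit_interval \<Rightarrow> real" is dist .

definition uniformity_unit_interval :: "(unit_interval \<times> unit_interval) filter" where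
  "uniformity_unit_interval = (INF e\<in>{0<..}. principal {(x, y). dist x y < e})"

definition open_unit_interval :: "unit_interval set \<Rightarrow> bool" where
  "open_unit_interval U = (\<forall>x\<in>U. eventually (\<lambda>(x', y). x' = x \<longrightarrow> y \<in> U) uniformity)"

instance
proof
  fix x y z :: unit_interval
  show "(dist x y = 0) = (x = y)" by transfer simp
  show "dist x y \<le> dist x z + dist y z" by transfer (rule dist_triangle2)
qed (simp_all only: uniformity_unit_interval_def open_unit_interval_def)

end

text \<open>
  The space \<open>C(I; X)\<close> with the uniform distance.  The next two lemmas show that the boundedness
  built into \<open>bcontfun\<close> is no restriction.
\<close>

type_synonym 'a curve = "unit_interval \<Rightarrow>\<^sub>C 'a"

lemma compact_UNIV_unit_interval: "compact (UNIV :: unit_interval set)"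
proof -
  have "continuous_on {0..1} Abs_unit_interval"
    unfolding continuous_on_iff
    by (auto simp: dist_unit_interval.rep_eq Abs_unit_interval_inverse)
  then have "compact (Abs_unit_interval ` {0..1})"
    by (intro compact_continuous_image) auto
  moreover have "Abs_unit_interval ` {0..1} = UNIV"
    by (auto simp: image_iff) (metis Abs_unit_interval_cases atLeastAtMost_iff)
  ultimately show ?thesis by simp
qed

lemma continuous_imp_bcontfun_unit_interval:
  fixes \<gamma> :: "unit_interval \<Rightarrow> 'a::metric_space"
  assumes "continuous_on UNIV \<gamma>"
  shows "\<gamma> \<in> bcontfun"
  using assms compact_continuous_image[OF assms compact_UNIV_unit_interval]
  by (auto simp: bcontfun_def intro: compact_imp_bounded)

text \<open>Evaluation at time \<open>t\<close>; only meaningful, and only used, for \<open>t \<in> [0, 1]\<close>.\<close>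

definition ev :: "real \<Rightarrow> 'a::metric_space curve \<Rightarrow> 'a" where
  "ev t \<gamma> = apply_bcontfun \<gamma> (Abs_unit_interval t)"

definition Geo :: "'a::metric_space curve set" where
  "Geo = {\<gamma>. \<forall>s\<in>{0..1}. \<forall>t\<in>{0..1}.
            dist (ev s \<gamma>) (ev t \<gamma>) = \<bar>s - t\<bar> * dist (ev 0 \<gamma>) (ev 1 \<gamma>)}"

definition geodesic_space :: "'a::metric_space itself \<Rightarrow> bool" where
  "geodesic_space _ \<longleftrightarrow> (\<forall>x y::'a. \<exists>\<gamma>\<in>Geo. ev 0 \<gamma> = x \<and> ev 1 \<gamma> = y)"

text \<open>
  The metric derivative, with the upper limit in place of the limit so that it is total (they
  agree wherever the limit exists, in particular along geodesics).
\<close>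

definition metric_speed :: "'a::metric_space curve \<Rightarrow> real \<Rightarrow> ennreal" where
  "metric_speed \<gamma> t =
     Limsup (at t within {0..1}) (\<lambda>s. ennreal (dist (ev s \<gamma>) (ev t \<gamma>) / \<bar>s - t\<bar>))"

section \<open>Metric measure spaces\<close>

definition borel_measure :: "'a::topological_space measure \<Rightarrow> bool" where
  "borel_measure m \<longleftrightarrow> sets m = sets borel"

definition msupp :: "'a::topological_space measure \<Rightarrow> 'a set" where
  "msupp m = {x. \<forall>U. open U \<and> x \<in> U \<longrightarrow> emeasure m U > 0}"

definition atomless :: "'a measure \<Rightarrow> bool" where
  "atomless m \<longleftrightarrow>
     (\<forall>A\<in>sets m. emeasure m A > 0 \<longrightarrow>
        (\<exists>B\<in>sets m. B \<subseteq> A \<and> 0 < emeasure m B \<and> emeasure m B < emeasure m A))"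

definition metric_measure_space :: "'a::polish_space measure \<Rightarrow> bool" where
  "metric_measure_space m \<longleftrightarrow>
     borel_measure m \<and> atomless m \<and>
     (\<forall>A\<in>sets m. bounded A \<longrightarrow> emeasure m A < \<infinity>) \<and>
     msupp m = UNIV"

section \<open>Optimal transport\<close>

definition P2 :: "'a::polish_space measure set" where
  "P2 = {\<mu>. prob_space \<mu> \<and> borel_measure \<mu> \<and>
            (\<exists>x0. (\<integral>\<^sup>+ x. ennreal ((dist x0 x)\<^sup>2) \<partial>\<mu>) < \<infinity>)}"

definition Pcm :: "'a::polish_space measure \<Rightarrow> 'a measure set" where
  "Pcm m = {\<mu>. prob_space \<mu> \<and> borel_measure \<mu> \<and> compact (msupp \<mu>) \<and> absolutely_continuous m \<mu>}"

definition couplings ::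
  "'a::polish_space measure \<Rightarrow> 'a measure \<Rightarrow> ('a \<times> 'a) measure set" where
  "couplings \<mu> \<nu> = {\<pi>. borel_measure \<pi> \<and> distr \<pi> borel fst = \<mu> \<and> distr \<pi> borel snd = \<nu>}"

text \<open>The infimum is finite for \<open>\<mu>, \<nu> \<in> P2\<close>, the only case in which \<open>W2\<close> is used.\<close>

definition W2 :: "'a::polish_space measure \<Rightarrow> 'a measure \<Rightarrow> real" where
  "W2 \<mu> \<nu> = sqrt (enn2real
     (INF \<pi>\<in>couplings \<mu> \<nu>. \<integral>\<^sup>+ z. ennreal ((dist (fst z) (snd z))\<^sup>2) \<partial>\<pi>))"

definition OptGeo ::
  "'a::polish_space measure \<Rightarrow> 'a measure \<Rightarrow> 'a curve measure set" where
  "OptGeo \<mu>0 \<mu>1 = {\<pi>. prob_space \<pi> \<and> borel_measure \<pi> \<and>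
     (AE \<gamma> in \<pi>. \<gamma> \<in> Geo) \<and>
     distr \<pi> borel (ev 0) = \<mu>0 \<and> distr \<pi> borel (ev 1) = \<mu>1 \<and>
     ennreal ((W2 \<mu>0 \<mu>1)\<^sup>2) =
       (\<integral>\<^sup>+ \<gamma>. (\<integral>\<^sup>+ t\<in>{0..1}. (metric_speed \<gamma> t)\<^sup>2 \<partial>lborel) \<partial>\<pi>)}"

definition monge_space :: "'a::polish_space measure \<Rightarrow> bool" where
  "monge_space m \<longleftrightarrow> metric_measure_space m \<and>
     (\<forall>\<mu>0\<in>P2. \<forall>\<mu>1\<in>P2. absolutely_continuous m \<mu>0 \<longrightarrow>
        (\<exists>!\<pi>. \<pi> \<in> OptGeo \<mu>0 \<mu>1) \<and>
        (\<forall>\<pi>\<in>OptGeo \<mu>0 \<mu>1.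
           (\<exists>T\<in>borel_measurable borel. range T \<subseteq> Geo \<and> \<pi> = distr \<mu>0 borel T) \<and>
           (\<forall>t\<in>{0..<1}. absolutely_continuous m (distr \<pi> borel (ev t)))))"

section \<open>Distortion coefficients and the quasi curvature-dimension condition\<close>

text \<open>
  \<open>sigma_coeff K N' t \<theta>\<close> and \<open>tau_coeff K N t \<theta>\<close> are the coefficients
  \<open>\<sigma>\<^sub>K\<^sub>,\<^sub>N\<^sub>'\<close> and \<open>\<tau>\<^sub>K\<^sub>,\<^sub>N\<close> at time \<open>t\<close>; \<open>N' = N - 1\<close> in \<open>tau_coeff\<close>.
\<close>

definition sigma_coeff :: "real \<Rightarrow> real \<Rightarrow> real \<Rightarrow> real \<Rightarrow> ennreal" where
  "sigma_coeff K N' t \<theta> =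
     (let \<kappa> = K / N' in
      if K = 0 \<or> \<theta> = 0 then ennreal t
      else if K > 0 then
        (if \<theta> < pi / sqrt \<kappa> then ennreal (sin (t * \<theta> * sqrt \<kappa>) / sin (\<theta> * sqrt \<kappa>)) else \<infinity>)
      else ennreal (sinh (t * \<theta> * sqrt (- \<kappa>)) / sinh (\<theta> * sqrt (- \<kappa>))))"

definition tau_coeff :: "real \<Rightarrow> real \<Rightarrow> real \<Rightarrow> real \<Rightarrow> ennreal" where
  "tau_coeff K N t \<theta> =
     (let s = sigma_coeff K (N - 1) t \<theta> in
      if s = \<infinity> then \<infinity> else ennreal (t powr (1 / N) * enn2real s powr (1 - 1 / N)))"

text \<open>
  A real-valued version of the Radon-Nikodym density.  If \<open>\<mu>\<close> is a probability measure with
  \<open>\<mu> \<lless> m\<close>, then \<open>RN_deriv m \<mu>\<close> lies in \<open>(0, \<infinity>)\<close> \<open>\<mu>\<close>-a.e., so the values of \<open>enn2real\<close> at \<open>\<infinity>\<close> and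
  of \<open>powr\<close> at \<open>0\<close> play no role below.
\<close>

definition rho :: "'a measure \<Rightarrow> 'a measure \<Rightarrow> 'a \<Rightarrow> real" where
  "rho m \<mu> x = enn2real (RN_deriv m \<mu> x)"

definition QCD :: "real \<Rightarrow> real \<Rightarrow> real \<Rightarrow> 'a::polish_space measure \<Rightarrow> bool" where
  "QCD Q K N m \<longleftrightarrow>
     (\<forall>\<mu>0\<in>Pcm m. \<forall>\<mu>1\<in>Pcm m. \<forall>\<pi>\<in>OptGeo \<mu>0 \<mu>1. \<forall>t\<in>{0<..<1}. AE \<gamma> in \<pi>.
        ennreal (rho m (distr \<pi> borel (ev t)) (ev t \<gamma>) powr (- 1 / N)) \<ge>
        ennreal (Q powr (- 1 / N)) *
          (tau_coeff K N (1 - t) (dist (ev 0 \<gamma>) (ev 1 \<gamma>)) * ennreal (rho m \<mu>0 (ev 0 \<gamma>) powr (- 1 / N))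
         + tau_coeff K N t (dist (ev 0 \<gamma>) (ev 1 \<gamma>)) * ennreal (rho m \<mu>1 (ev 1 \<gamma>) powr (- 1 / N))))"

section \<open>Cheeger energy and Sobolev spaces\<close>

text \<open>The upper limit is finite for Lipschitz \<open>f\<close>, the only case in which \<open>slope\<close> is used.\<close>

definition slope :: "('a::metric_space \<Rightarrow> real) \<Rightarrow> 'a \<Rightarrow> real" where
  "slope f x = (if open {x} then 0
     else enn2real (Limsup (at x) (\<lambda>y. ennreal (\<bar>f y - f x\<bar> / dist x y))))"

definition Lip_bs :: "('a::metric_space \<Rightarrow> real) set" where
  "Lip_bs = {f. (\<exists>L. L-lipschitz_on UNIV f) \<and> bounded (closure {x. f x \<noteq> 0})}"

definition L2 :: "'a measure \<Rightarrow> ('a \<Rightarrow> real) set" where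
  "L2 m = {f \<in> borel_measurable m. integrable m (\<lambda>x. (f x)\<^sup>2)}"

definition L2_norm :: "'a measure \<Rightarrow> ('a \<Rightarrow> real) \<Rightarrow> real" where
  "L2_norm m f = sqrt (\<integral>x. (f x)\<^sup>2 \<partial>m)"

definition L2_tendsto :: "'a measure \<Rightarrow> (nat \<Rightarrow> 'a \<Rightarrow> real) \<Rightarrow> ('a \<Rightarrow> real) \<Rightarrow> bool" where
  "L2_tendsto m u f \<longleftrightarrow> (\<forall>n. u n \<in> L2 m) \<and> f \<in> L2 m \<and>
     (\<lambda>n. L2_norm m (\<lambda>x. u n x - f x)) \<longlonglongrightarrow> 0"

definition L2_weak_tendsto :: "'a measure \<Rightarrow> (nat \<Rightarrow> 'a \<Rightarrow> real) \<Rightarrow> ('a \<Rightarrow> real) \<Rightarrow> bool" where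
  "L2_weak_tendsto m u g \<longleftrightarrow> (\<forall>n. u n \<in> L2 m) \<and> g \<in> L2 m \<and>
     (\<forall>h\<in>L2 m. (\<lambda>n. \<integral>x. u n x * h x \<partial>m) \<longlonglongrightarrow> (\<integral>x. g x * h x \<partial>m))"

definition Ch :: "'a::polish_space measure \<Rightarrow> ('a \<Rightarrow> real) \<Rightarrow> ennreal" where
  "Ch m f = Inf {liminf (\<lambda>n. \<integral>\<^sup>+ x. ennreal ((slope (u n) x)\<^sup>2) \<partial>m) | u.
                   (\<forall>n. u n \<in> Lip_bs) \<and> L2_tendsto m u f}"

definition W12 :: "'a::polish_space measure \<Rightarrow> ('a \<Rightarrow> real) set" where
  "W12 m = {f \<in> L2 m. Ch m f < \<infinity>}"

definition infinitesimally_hilbertian :: "'a::polish_space measure \<Rightarrow> bool" where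
  "infinitesimally_hilbertian m \<longleftrightarrow>
     (\<forall>f\<in>L2 m. \<forall>g\<in>L2 m.
        Ch m (\<lambda>x. f x + g x) + Ch m (\<lambda>x. f x - g x) = 2 * Ch m f + 2 * Ch m g)"

definition relaxed_slopes :: "'a::polish_space measure \<Rightarrow> ('a \<Rightarrow> real) \<Rightarrow> ('a \<Rightarrow> real) set" where
  "relaxed_slopes m f =
     {g. \<exists>u. (\<forall>n. u n \<in> Lip_bs) \<and> L2_tendsto m u f \<and> L2_weak_tendsto m (\<lambda>n. slope (u n)) g}"

text \<open>
  Weak minimal upper gradients are determined only up to \<open>m\<close>-null sets:
  \<open>is_wgrad m f g\<close> says that \<open>g\<close> is a representative of \<open>|Df|\<^sub>w\<close>, for \<open>f \<in> W12 m\<close>.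
\<close>

definition is_wgrad :: "'a::polish_space measure \<Rightarrow> ('a \<Rightarrow> real) \<Rightarrow> ('a \<Rightarrow> real) \<Rightarrow> bool" where
  "is_wgrad m f g \<longleftrightarrow> g \<in> relaxed_slopes m f \<and> (\<forall>h\<in>relaxed_slopes m f. L2_norm m g \<le> L2_norm m h)"

definition W12_loc :: "'a::polish_space measure \<Rightarrow> ('a \<Rightarrow> real) set" where
  "W12_loc m = {f \<in> borel_measurable m.
     \<forall>G. open G \<and> compact (closure G) \<longrightarrow> (\<exists>fG\<in>W12 m. AE x in m. x \<in> G \<longrightarrow> f x = fG x)}"

text \<open>\<open>is_wgrad_loc m f g\<close>: \<open>g\<close> is a representative of \<open>|Df|\<^sub>w\<close>, for \<open>f \<in> W12_loc m\<close>.\<close>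

definition is_wgrad_loc :: "'a::polish_space measure \<Rightarrow> ('a \<Rightarrow> real) \<Rightarrow> ('a \<Rightarrow> real) \<Rightarrow> bool" where
  "is_wgrad_loc m f g \<longleftrightarrow> g \<in> borel_measurable m \<and>
     (\<forall>G. open G \<and> compact (closure G) \<longrightarrow>
        (\<forall>fG\<in>W12 m. (AE x in m. x \<in> G \<longrightarrow> f x = fG x) \<longrightarrow>
           (\<exists>gG. is_wgrad m fG gG \<and> (AE x in m. x \<in> G \<longrightarrow> g x = gG x))))"

definition L_infty :: "'a measure \<Rightarrow> ('a \<Rightarrow> real) set" where
  "L_infty m = {f \<in> borel_measurable m. \<exists>C. AE x in m. \<bar>f x\<bar> \<le> C}"

end

theory Submission
  imports Defs
begin

text \<open>
  Let \<open>x\<close>, \<open>y\<close> be points, \<open>\<epsilon> > 0\<close>, and take compact sets of positive measure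
  \<open>A\<^sub>0 \<subseteq> B\<^sub>\<epsilon>(x) \<inter> {f > a}\<close> and \<open>A\<^sub>1 \<subseteq> B\<^sub>\<epsilon>(y) \<inter> {f < b}\<close>.  The curvature-dimension
  inequality bounds the densities of the interpolants between the normalized restrictions of \<open>m\<close>
  to \<open>A\<^sub>0\<close> and \<open>A\<^sub>1\<close> uniformly in time, so their time average \<open>\<nu>\<close> has an \<open>L\<^sup>2\<close> density.  For
  Lipschitz \<open>u\<close> the slope is an upper gradient along the transport geodesics, whence
  \<open>\<integral> u d\<mu>\<^sub>0 - \<integral> u d\<mu>\<^sub>1 \<le> (d(x, y) + 2 \<epsilon>) \<integral> |Du| d\<nu>\<close>.  This passes to the weak limits defining
  \<open>|Df|\<^sub>w \<le> 1\<close> and gives \<open>a - b \<le> d(x, y) + 2 \<epsilon>\<close>.  Letting \<open>a\<close>, \<open>b\<close> range over the rationals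
  and the balls over a countable basis, \<open>f\<close> is 1-Lipschitz off a null set.

  Localization uses relatively compact sets, so balls must be precompact.  This also comes from the
  density bound: transporting a fixed set towards the centres bounds the measure of small balls
  from below.
\<close>

section \<open>Lower bounds for the distortion coefficients\<close>

text \<open>Sine is concave on \<open>[0, pi]\<close>, so its graph lies above the chord from 0 to
  \<open>z\<close>.\<close>

lemma sin_scale_ge:
  fixes t z :: real
  assumes "0 \<le> t" "t \<le> 1" "0 \<le> z" "z \<le> pi"
  shows "t * sin z \<le> sin (t * z)"
proof -
  have "convex_on {0..pi} (\<lambda>x. - sin x)"
  proof (rule f''_ge0_imp_convex)
    show "((\<lambda>x. - sin x) has_real_derivative - cos x) (at x)" for x :: real
      by (auto intro!: derivative_eq_intros)
    show "((\<lambda>x. - cos x) has_real_derivative sin x) (at x)" for x :: real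
      by (auto intro!: derivative_eq_intros)
    show "0 \<le> sin x" if "x \<in> {0..pi}" for x
      using that by (auto intro: sin_ge_zero)
  qed auto
  from convex_onD[OF this, of t 0 z] assms show ?thesis by simp
qed

lemma sinh_ge_self:
  fixes z :: real
  assumes "0 \<le> z"
  shows "z \<le> sinh z"
proof -
  have "sinh 0 - 0 \<le> sinh z - z"
    by (rule DERIV_nonneg_imp_nondecreasing[OF assms])
       (auto intro!: exI derivative_eq_intros simp: cosh_real_ge_1)
  then show ?thesis by simp
qed

lemma sinh_le_mult_cosh:
  fixes z :: real
  assumes "0 \<le> z"
  shows "sinh z \<le> z * cosh z"
proof -
  have "0 * cosh 0 - sinh 0 \<le> z * cosh z - sinh z"
    by (rule DERIV_nonneg_imp_nondecreasing[OF assms])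
       (auto intro!: exI derivative_eq_intros)
  then show ?thesis by simp
qed

text \<open>The bound is linear in \<open>t\<close> and uniform over bounded distances. For
  \<open>K > 0\<close> concavity of sine gives \<open>t\<close> itself; for \<open>K < 0\<close>,
  with \<open>z\<close> the rescaled distance, \<open>sinh (t * z) / sinh z\<close> is at least
  \<open>t * z / sinh z\<close>, hence at least \<open>t / cosh z\<close>.\<close>

lemma sigma_coeff_ge:
  fixes K N' D :: real
  assumes "N' > 0"
  obtains c where "0 < c" "c \<le> 1"
    "\<And>t \<theta>. 0 < t \<Longrightarrow> t < 1 \<Longrightarrow> 0 \<le> \<theta> \<Longrightarrow> \<theta> \<le> D \<Longrightarrow> ennreal (c * t) \<le> sigma_coeff K N' t \<theta>"
proof -
  \<comment> \<open>Only \<open>K < 0\<close> uses \<open>Z\<close> as a rescaled distance. For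
    \<open>K > 0\<close> the root of a negative number is negative in HOL, which is harmless: there
    only \<open>cosh Z \<ge> 1\<close>, that is \<open>c \<le> 1\<close>, enters.\<close>
  define Z where "Z = D * sqrt (- (K / N'))"
  define c where "c = 1 / cosh Z"
  have c: "0 < c" "c \<le> 1"
    using cosh_real_ge_1[of Z] by (auto simp: c_def)
  have ct: "c * t \<le> t" if "0 < t" for t
    using c that by (simp add: mult_le_cancel_right1)
  have "ennreal (c * t) \<le> sigma_coeff K N' t \<theta>"
    if t: "0 < t" "t < 1" and \<theta>: "0 \<le> \<theta>" "\<theta> \<le> D" for t \<theta>
  proof -
    consider "K = 0 \<or> \<theta> = 0" | "K > 0" "\<theta> > 0" "\<theta> < pi / sqrt (K / N')"
      | "K > 0" "\<theta> > 0" "\<not> \<theta> < pi / sqrt (K / N')" | "K < 0" "\<theta> > 0"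
      using \<theta> by fastforce
    then show ?thesis
    proof cases
      case 1
      then show ?thesis using ct[OF t(1)] by (auto simp: sigma_coeff_def intro: ennreal_leI)
    next
      case 2
      define z where "z = \<theta> * sqrt (K / N')"
      have "sqrt (K / N') > 0" using 2 assms by simp
      then have z: "0 < z" "z < pi"
        using 2 by (auto simp: z_def field_simps)
      have "t * sin z \<le> sin (t * z)"
        using sin_scale_ge[of t z] t z by auto
      then have "t \<le> sin (t * z) / sin z"
        using sin_gt_zero[OF z] by (simp add: field_simps)
      then have "ennreal (c * t) \<le> ennreal (sin (t * z) / sin z)"
        using ct[OF t(1)] by (intro ennreal_leI) linarith
      then show ?thesis
        using 2 by (simp add: sigma_coeff_def Let_def z_def mult.assoc)
    next
      case 3
      then show ?thesis by (simp add: sigma_coeff_def Let_def)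
    next
      case 4
      define z where "z = \<theta> * sqrt (- (K / N'))"
      have pos: "sqrt (- (K / N')) > 0" using 4 assms by (simp add: divide_neg_pos)
      have z: "0 < z" "z \<le> Z"
        using 4 \<theta> pos by (auto simp: z_def Z_def intro!: mult_right_mono)
      have "sinh z \<le> z * cosh z" using z by (intro sinh_le_mult_cosh) auto
      also have "\<dots> \<le> z * cosh Z" using z by (intro mult_left_mono) (auto simp: cosh_real_nonneg_le_iff)
      finally have "c * sinh z \<le> z"
        by (simp add: c_def divide_le_eq)
      then have "c * t * sinh z \<le> t * z"
        using t by (metis mult.commute mult.left_commute mult_le_cancel_left_pos)
      also have "\<dots> \<le> sinh (t * z)" using t z by (intro sinh_ge_self) auto
      finally have "ennreal (c * t) \<le> ennreal (sinh (t * z) / sinh z)"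
        using z by (intro ennreal_leI) (simp add: le_divide_eq)
      then show ?thesis
        using 4 by (simp add: sigma_coeff_def Let_def z_def mult.assoc)
    qed
  qed
  with c that show thesis by blast
qed

text \<open>The exponents \<open>1 / N\<close> and \<open>1 - 1 / N\<close> add up to 1, so the
  linear lower bound for \<open>sigma_coeff\<close> is inherited with the same constant.\<close>

lemma tau_coeff_ge:
  fixes K N D :: real
  assumes "N > 1"
  obtains c where "0 < c"
    "\<And>t \<theta>. 0 < t \<Longrightarrow> t < 1 \<Longrightarrow> 0 \<le> \<theta> \<Longrightarrow> \<theta> \<le> D \<Longrightarrow> ennreal (c * t) \<le> tau_coeff K N t \<theta>"
proof -
  obtain c where c: "0 < c" "c \<le> 1"
    and ge: "\<And>t \<theta>. 0 < t \<Longrightarrow> t < 1 \<Longrightarrow> 0 \<le> \<theta> \<Longrightarrow> \<theta> \<le> D \<Longrightarrow> ennreal (c * t) \<le> sigma_coeff K (N - 1) t \<theta>"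
    using sigma_coeff_ge[of "N - 1" D K] assms by auto
  have "ennreal (c * t) \<le> tau_coeff K N t \<theta>"
    if t: "0 < t" "t < 1" and \<theta>: "0 \<le> \<theta>" "\<theta> \<le> D" for t \<theta>
  proof (cases "sigma_coeff K (N - 1) t \<theta> = \<infinity>")
    case True
    then show ?thesis by (simp add: tau_coeff_def)
  next
    case False
    define s where "s = enn2real (sigma_coeff K (N - 1) t \<theta>)"
    have "sigma_coeff K (N - 1) t \<theta> = ennreal s"
      using False by (simp add: s_def less_top)
    then have s: "c * t \<le> s"
      using ge[OF t \<theta>] by (metis ennreal_le_iff enn2real_nonneg s_def)
    have e: "0 \<le> 1 - 1 / N" using assms by simp
    have "c * t = (c * t) powr (1 / N) * (c * t) powr (1 - 1 / N)"
      using c t by (simp flip: powr_add)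
    \<comment> \<open>The first factor uses \<open>c \<le> 1\<close>, the second the bound for
      \<open>s\<close>.\<close>
    also have "\<dots> \<le> t powr (1 / N) * s powr (1 - 1 / N)"
      using c t s e assms by (intro mult_mono powr_mono2) (auto simp: mult_le_cancel_right1)
    finally show ?thesis
      using False by (auto simp: tau_coeff_def Let_def s_def[symmetric] intro: ennreal_leI)
  qed
  with c that show thesis by blast
qed

section \<open>Densities of interpolating measures\<close>

lemma continuous_ev: "continuous_on UNIV (ev t :: 'a::metric_space curve \<Rightarrow> 'a)"
  unfolding ev_def continuous_on_iff
  using dist_bounded by (metis UNIV_I le_less_trans)

lemma borel_measurable_ev [measurable]:
  "(ev t :: 'a::metric_space curve \<Rightarrow> 'a) \<in> borel_measurable borel"
  by (intro borel_measurable_continuous_onI continuous_ev)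

lemma (in sigma_finite_measure) emeasure_le_of_RN_deriv_le:
  assumes ac: "absolutely_continuous M L" and sets: "sets L = sets M"
    and le: "AE x in L. RN_deriv M L x \<le> C" and E: "E \<in> sets M"
  shows "emeasure L E \<le> C * emeasure M E"
proof -
  have L: "L = density M (RN_deriv M L)" by (simp add: density_RN_deriv[OF ac sets])
  have "AE x in density M (RN_deriv M L). RN_deriv M L x \<le> C"
    by (subst L[symmetric]) (rule le)
  \<comment> \<open>The set where the density vanishes is invisible to \<open>L\<close>, but there
    the bound is trivial.\<close>
  then have *: "AE x in M. RN_deriv M L x \<le> C"
    by (subst (asm) AE_density) (auto elim!: eventually_mono simp: zero_less_iff_neq_zero)
  have "emeasure L E = (\<integral>\<^sup>+ x. RN_deriv M L x * indicator E x \<partial>M)"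
    using E by (subst L) (simp add: emeasure_density)
  also have "\<dots> \<le> (\<integral>\<^sup>+ x. C * indicator E x \<partial>M)"
    using * by (intro nn_integral_mono_AE) (auto elim!: eventually_mono split: split_indicator)
  also have "\<dots> = C * emeasure M E" using E by (simp add: nn_integral_cmult)
  finally show ?thesis .
qed

lemma msupp_uniform_measure_subset:
  fixes m :: "'a::t2_space measure"
  assumes "sets m = sets borel" "compact A"
  shows "msupp (uniform_measure m A) \<subseteq> A"
proof
  fix x assume x: "x \<in> msupp (uniform_measure m A)"
  have A: "A \<in> sets m" "- A \<in> sets m" "open (- A)"
    using assms by (auto simp: compact_imp_closed borel_compact)
  show "x \<in> A"
  proof (rule ccontr)
    assume "x \<notin> A"
    then have "emeasure (uniform_measure m A) (- A) > 0"
      using x A by (auto simp: msupp_def)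
    then show False using A by simp
  qed
qed

lemma closed_msupp: "closed (msupp m)"
proof -
  have "- msupp m = \<Union>{U. open U \<and> \<not> emeasure m U > 0}"
    by (auto simp: msupp_def)
  then show ?thesis by (metis (no_types, lifting) closed_open mem_Collect_eq open_Union)
qed

section \<open>Basic measure theory of the space and normalized restrictions to compact sets\<close>

locale qcd_space =
  fixes m :: "'a::polish_space measure" and Q K N :: real
  assumes Q: "Q \<ge> 1" and N: "N > 1" and monge: "monge_space m" and qcd: "QCD Q K N m"
begin

lemma sets_m [simp, measurable_cong]: "sets m = sets borel"
  using monge by (auto simp: monge_space_def metric_measure_space_def borel_measure_def)

lemma space_m [simp]: "space m = UNIV"
  using sets_eq_imp_space_eq[OF sets_m] by simp

lemma emeasure_bounded: "A \<in> sets borel \<Longrightarrow> bounded A \<Longrightarrow> emeasure m A < \<infinity>"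
  using monge by (auto simp: monge_space_def metric_measure_space_def)

lemma emeasure_open_pos: "open U \<Longrightarrow> x \<in> U \<Longrightarrow> emeasure m U > 0"
  using monge by (auto simp: monge_space_def metric_measure_space_def msupp_def)

lemma emeasure_compact: "compact A \<Longrightarrow> emeasure m A < \<infinity>"
  by (intro emeasure_bounded) (auto simp: compact_imp_bounded borel_compact)

sublocale sigma_finite_measure m
proof
  let ?A = "range (\<lambda>n::nat. ball (undefined::'a) (real n))"
  have "\<Union> ?A = UNIV" using reals_Archimedean2 by (auto simp: set_eq_iff)
  then show "\<exists>A. countable A \<and> A \<subseteq> sets m \<and> \<Union> A = space m \<and> (\<forall>a\<in>A. emeasure m a \<noteq> \<infinity>)"
    using emeasure_bounded[of "ball undefined (real _)"]
    by (intro exI[of _ ?A]) (auto simp: less_top)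
qed

lemma OptGeo_nonempty:
  assumes "\<mu>0 \<in> P2" "\<mu>1 \<in> P2" "absolutely_continuous m \<mu>0"
  shows "OptGeo \<mu>0 \<mu>1 \<noteq> {}"
  using monge assms unfolding monge_space_def by blast

lemma OptGeo_ac:
  assumes "\<mu>0 \<in> P2" "\<mu>1 \<in> P2" "absolutely_continuous m \<mu>0" "\<pi> \<in> OptGeo \<mu>0 \<mu>1" "0 \<le> t" "t < 1"
  shows "absolutely_continuous m (distr \<pi> borel (ev t))"
  using monge assms unfolding monge_space_def by (metis atLeastLessThan_iff)

text \<open>\<open>m\<close> may be infinite, so inner regularity of finite Borel measures on Polish
  spaces is applied to \<open>M\<close>, the restriction of \<open>m\<close> to a ball that meets
  \<open>E\<close> in positive measure.\<close>

lemma inner_compact: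
  assumes "E \<in> sets borel" "emeasure m E > 0"
  obtains A where "compact A" "A \<subseteq> E" "emeasure m A > 0"
proof -
  let ?B = "\<lambda>n::nat. ball (undefined::'a) (real n)"
  have "\<exists>n. emeasure m (E \<inter> ?B n) > 0"
  proof (rule ccontr)
    assume "\<not> ?thesis"
    then have "\<And>n. E \<inter> ?B n \<in> null_sets m" using assms by (auto simp: null_sets_def zero_less_iff_neq_zero)
    then have "(\<Union>n. E \<inter> ?B n) \<in> null_sets m" by blast
    moreover have "(\<Union>n. E \<inter> ?B n) = E" using reals_Archimedean2 by auto
    ultimately show False using assms by auto
  qed
  then obtain n where n: "emeasure m (E \<inter> ?B n) > 0" by blast
  define M where "M = density m (indicator (?B n))"
  have M: "emeasure M S = emeasure m (?B n \<inter> S)" if "S \<in> sets borel" for S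
  proof -
    have [measurable]: "?B n \<in> sets m" "S \<in> sets m" using that by auto
    have "emeasure M S = (\<integral>\<^sup>+ x. indicator (?B n) x * indicator S x \<partial>m)"
      unfolding M_def by (rule emeasure_density) measurable
    then show ?thesis by (simp flip: indicator_inter_arith)
  qed
  have "emeasure M E = (SUP A \<in> {A. A \<subseteq> E \<and> compact A}. emeasure M A)"
  proof (rule inner_regular)
    show "sets M = sets borel" by (simp add: M_def)
    have "space M = UNIV" by (simp add: M_def)
    then show "emeasure M (space M) \<noteq> \<infinity>" using emeasure_bounded[of "?B n"] M[of UNIV] by simp
  qed (use assms in simp)
  moreover have "emeasure M E > 0" using assms n by (simp add: M Int_commute)
  ultimately obtain A where A: "A \<subseteq> E" "compact A" "emeasure M A > 0"
    by (auto simp: less_SUP_iff)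
  have "emeasure M A \<le> emeasure m A"
    using A by (simp add: M borel_compact emeasure_mono)
  with A show thesis by (intro that[of A]) auto
qed

lemma prob_space_uniform: "compact A \<Longrightarrow> emeasure m A > 0 \<Longrightarrow> prob_space (uniform_measure m A)"
  using emeasure_compact[of A] by (intro prob_space_uniform_measure) auto

lemma uniform_ac: "compact A \<Longrightarrow> absolutely_continuous m (uniform_measure m A)"
  unfolding uniform_measure_def
  by (intro absolutely_continuousI_density borel_measurable_divide_ennreal borel_measurable_indicator)
    (auto simp: borel_compact)

lemma uniform_in_Pcm:
  assumes "compact A" "emeasure m A > 0"
  shows "uniform_measure m A \<in> Pcm m"
proof -
  have "compact (msupp (uniform_measure m A))"
    using msupp_uniform_measure_subset[OF sets_m assms(1)] closed_msupp assms(1)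
    by (metis compact_Int_closed inf.absorb_iff2)
  then show ?thesis
    using assms by (simp add: Pcm_def borel_measure_def prob_space_uniform uniform_ac)
qed

lemma AE_uniform_mem:
  assumes "compact A"
  shows "AE x in uniform_measure m A. x \<in> A"
  using assms by (intro AE_uniform_measureI) (auto simp: borel_compact)

lemma uniform_in_P2:
  assumes "compact A" "emeasure m A > 0"
  shows "uniform_measure m A \<in> P2"
proof -
  interpret U: prob_space "uniform_measure m A" using assms by (rule prob_space_uniform)
  obtain x0 r where r: "A \<subseteq> cball x0 r"
    using compact_imp_bounded[OF assms(1)] by (auto simp: bounded_def subset_eq)
  have "(\<integral>\<^sup>+ x. ennreal ((dist x0 x)\<^sup>2) \<partial>uniform_measure m A) \<le> (\<integral>\<^sup>+ x. ennreal (r\<^sup>2) \<partial>uniform_measure m A)"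
    using AE_uniform_mem[OF assms(1)] r
    by (intro nn_integral_mono_AE) (auto elim!: eventually_mono intro!: ennreal_leI power_mono)
  also have "\<dots> < \<infinity>"
    using U.emeasure_space_1 by simp
  finally show ?thesis
    by (auto simp: P2_def borel_measure_def U.prob_space_axioms)
qed

lemma measure_compact_pos:
  assumes "compact A" "emeasure m A > 0"
  shows "measure m A > 0"
  using assms emeasure_compact[OF assms(1)]
  by (simp add: measure_def enn2real_positive_iff)

text \<open>The normalized indicator is a density of the uniform measure, and Radon-Nikodym
  densities are unique up to null sets.\<close>

lemma rho_uniform:
  assumes "compact A" "emeasure m A > 0"
  shows "AE x in uniform_measure m A. rho m (uniform_measure m A) x = 1 / measure m A"
proof -
  have fin: "emeasure m A < \<infinity>" by (rule emeasure_compact[OF assms(1)])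
  have "AE x in m. indicator A x / emeasure m A = RN_deriv m (uniform_measure m A) x"
    using assms
    by (intro RN_deriv_unique borel_measurable_divide_ennreal borel_measurable_indicator)
      (auto simp: uniform_measure_def borel_compact)
  moreover have "enn2real (1 / emeasure m A) = 1 / measure m A"
  proof -
    have "emeasure m A = ennreal (measure m A)" "measure m A > 0"
      using measure_compact_pos[OF assms] fin by (simp_all add: emeasure_eq_ennreal_measure)
    then have "1 / emeasure m A = ennreal (1 / measure m A)"
      by (metis divide_ennreal ennreal_1 zero_le_one)
    then show ?thesis by simp
  qed
  ultimately have "AE x in m. x \<in> A \<longrightarrow> rho m (uniform_measure m A) x = 1 / measure m A"
    by (auto elim!: eventually_mono simp: rho_def)
  then show ?thesis
    using assms fin by (subst AE_uniform_measure) auto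
qed

text \<open>With constant endpoint densities \<open>1 / measure m A0\<close> and
  \<open>1 / measure m A1\<close>, any lower bound \<open>b\<close> for the right-hand side of the
  \<open>QCD\<close> inequality says that the density at time \<open>t\<close> is at most
  \<open>b powr (- N)\<close> along almost every geodesic. Pushing this forward by
  \<open>ev t\<close> and integrating turns it into an inequality between measures.\<close>

lemma interpolation_density_bound:
  assumes "emeasure m A0 > 0" "emeasure m A1 > 0" "compact A0" "compact A1"
    and \<pi>: "\<pi> \<in> OptGeo (uniform_measure m A0) (uniform_measure m A1)" and t: "0 < t" "t < 1"
    and b: "b > 0"
    and le: "\<And>x y. x \<in> A0 \<Longrightarrow> y \<in> A1 \<Longrightarrow> ennreal b \<le> ennreal (Q powr (- 1 / N)) *
          (tau_coeff K N (1 - t) (dist x y) * ennreal (measure m A0 powr (1 / N))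
         + tau_coeff K N t (dist x y) * ennreal (measure m A1 powr (1 / N)))"
    and E: "E \<in> sets borel"
  shows "emeasure (distr \<pi> borel (ev t)) E \<le> ennreal (b powr (- N)) * emeasure m E"
proof -
  let ?u = "\<lambda>A. uniform_measure m A"
  have [simp]: "sets \<pi> = sets borel" and d0: "distr \<pi> borel (ev 0) = ?u A0" and d1: "distr \<pi> borel (ev 1) = ?u A1"
    using \<pi> by (auto simp: OptGeo_def borel_measure_def)
  have [measurable_cong]: "sets \<pi> = sets borel" by simp
  have ac: "absolutely_continuous m (distr \<pi> borel (ev t))"
    using assms by (intro OptGeo_ac[OF _ _ _ \<pi>] uniform_in_P2 uniform_ac) auto
  have ev0: "AE \<gamma> in \<pi>. P (ev 0 \<gamma>)" if "AE x in ?u A0. P x" for P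
    using that unfolding d0[symmetric] by (rule AE_distrD[rotated]) measurable
  have ev1: "AE \<gamma> in \<pi>. P (ev 1 \<gamma>)" if "AE x in ?u A1. P x" for P
    using that unfolding d1[symmetric] by (rule AE_distrD[rotated]) measurable
  have p: "(1 / a) powr (- 1 / N) = a powr (1 / N)" if "a > 0" for a :: real
    using that by (simp add: powr_divide powr_minus field_simps)
  have "AE \<gamma> in \<pi>.
        ennreal (rho m (distr \<pi> borel (ev t)) (ev t \<gamma>) powr (- 1 / N)) \<ge>
        ennreal (Q powr (- 1 / N)) *
          (tau_coeff K N (1 - t) (dist (ev 0 \<gamma>) (ev 1 \<gamma>)) * ennreal (rho m (?u A0) (ev 0 \<gamma>) powr (- 1 / N))
         + tau_coeff K N t (dist (ev 0 \<gamma>) (ev 1 \<gamma>)) * ennreal (rho m (?u A1) (ev 1 \<gamma>) powr (- 1 / N)))"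
    using qcd uniform_in_Pcm assms t unfolding QCD_def by auto
  moreover note ev0[OF rho_uniform[OF assms(3,1)]] ev0[OF AE_uniform_mem[OF assms(3)]]
    ev1[OF rho_uniform[OF assms(4,2)]] ev1[OF AE_uniform_mem[OF assms(4)]]
  ultimately have "AE \<gamma> in \<pi>. RN_deriv m (distr \<pi> borel (ev t)) (ev t \<gamma>) \<le> ennreal (b powr (- N))"
  proof eventually_elim
    case (elim \<gamma>)
    define r where "r = rho m (distr \<pi> borel (ev t)) (ev t \<gamma>)"
    have "ennreal b \<le> ennreal (r powr (- 1 / N))"
      using order_trans[OF le[OF elim(3,5)] elim(1)[unfolded elim(2,4) p[OF measure_compact_pos[OF assms(3,1)]]
          p[OF measure_compact_pos[OF assms(4,2)]]]]
      by (simp only: r_def)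
    then have b': "b \<le> r powr (- 1 / N)" by (simp add: ennreal_le_iff)
    \<comment> \<open>In HOL \<open>0 powr a = 0\<close>, so \<open>b > 0\<close> excludes
      \<open>r = 0\<close>. This also excludes an infinite value of \<open>RN_deriv\<close>, which
      \<open>enn2real\<close> would send to 0.\<close>
    with b have "r \<noteq> 0" by auto
    moreover have "r \<ge> 0" by (simp add: r_def rho_def)
    ultimately have "r > 0" by simp
    have "r = (r powr (- 1 / N)) powr (- N)" using N \<open>r > 0\<close> by (simp add: powr_powr)
    also have "\<dots> \<le> b powr (- N)" using b b' N by (intro powr_mono2') auto
    finally have "r \<le> b powr (- N)" .
    moreover have "RN_deriv m (distr \<pi> borel (ev t)) (ev t \<gamma>) = ennreal r"
      using \<open>r > 0\<close> by (auto simp: r_def rho_def enn2real_positive_iff)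
    ultimately show ?case by (simp add: ennreal_leI)
  qed
  then have "AE x in distr \<pi> borel (ev t). RN_deriv m (distr \<pi> borel (ev t)) x \<le> ennreal (b powr (- N))"
    by (subst AE_distr_iff) auto
  from emeasure_le_of_RN_deriv_le[OF ac _ this] E show ?thesis by auto
qed

text \<open>The two bounds arise by keeping only one endpoint term of the \<open>QCD\<close>
  inequality. The first is independent of the size of \<open>A1\<close> and degenerates only as
  \<open>t\<close> tends to 1; the second is its mirror image.\<close>

definition controlled_plans :: "real \<Rightarrow> 'a set \<Rightarrow> 'a set \<Rightarrow> 'a curve measure set" where
  "controlled_plans c A0 A1 = {\<pi> \<in> OptGeo (uniform_measure m A0) (uniform_measure m A1).
     \<forall>t\<in>{0<..<1}. \<forall>E\<in>sets borel.
        emeasure (distr \<pi> borel (ev t)) E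
          \<le> ennreal ((c * (1 - t) * measure m A0 powr (1 / N)) powr (- N)) * emeasure m E \<and>
        emeasure (distr \<pi> borel (ev t)) E
          \<le> ennreal ((c * t * measure m A1 powr (1 / N)) powr (- N)) * emeasure m E}"

text \<open>The constant is fixed before the sets: besides \<open>Q\<close>, \<open>K\<close>,
  \<open>N\<close> it depends only on the distance bound \<open>D\<close>. This uniformity is what
  makes the volume estimate for balls independent of their centres.\<close>

lemma controlled_plans_nonempty:
  obtains c where "c > 0"
    "\<forall>A0 A1. compact A0 \<and> compact A1 \<and> emeasure m A0 > 0 \<and> emeasure m A1 > 0 \<and>
      (\<forall>x\<in>A0. \<forall>y\<in>A1. dist x y \<le> D) \<longrightarrow> controlled_plans c A0 A1 \<noteq> {}"
proof -
  obtain c where c: "0 < c"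
    "\<And>t \<theta>. 0 < t \<Longrightarrow> t < 1 \<Longrightarrow> 0 \<le> \<theta> \<Longrightarrow> \<theta> \<le> D \<Longrightarrow> ennreal (c * t) \<le> tau_coeff K N t \<theta>"
    using tau_coeff_ge[OF N] by blast
  define q where "q = Q powr (- 1 / N)"
  have q: "q > 0" using Q by (simp add: q_def)
  show thesis
  proof (rule that[of "q * c"], goal_cases)
    case 1
    show ?case using q c by simp
  next
    case 2
    show ?case
    proof (intro allI impI, elim conjE)
      fix A0 A1
      assume A: "compact A0" "compact A1" "emeasure m A0 > 0" "emeasure m A1 > 0"
        and "\<forall>x\<in>A0. \<forall>y\<in>A1. dist x y \<le> D"
      then have D: "\<And>x y. x \<in> A0 \<Longrightarrow> y \<in> A1 \<Longrightarrow> dist x y \<le> D" by blast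
      note pos = measure_compact_pos[OF A(1,3)] measure_compact_pos[OF A(2,4)]
      obtain \<pi> where \<pi>: "\<pi> \<in> OptGeo (uniform_measure m A0) (uniform_measure m A1)"
        using OptGeo_nonempty uniform_in_P2 uniform_ac A by blast
      have "emeasure (distr \<pi> borel (ev t)) E
            \<le> ennreal ((q * c * (1 - t) * measure m A0 powr (1 / N)) powr (- N)) * emeasure m E"
        "emeasure (distr \<pi> borel (ev t)) E
            \<le> ennreal ((q * c * t * measure m A1 powr (1 / N)) powr (- N)) * emeasure m E"
        if t: "0 < t" "t < 1" and E: "E \<in> sets borel" for t E
      proof -
        have "ennreal (q * c * (1 - t) * measure m A0 powr (1 / N)) \<le> ennreal (Q powr (- 1 / N)) *
            (tau_coeff K N (1 - t) (dist x y) * ennreal (measure m A0 powr (1 / N))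
           + tau_coeff K N t (dist x y) * ennreal (measure m A1 powr (1 / N)))"
          if "x \<in> A0" "y \<in> A1" for x y
        proof -
          have "ennreal (q * c * (1 - t) * measure m A0 powr (1 / N)) =
            ennreal q * (ennreal (c * (1 - t)) * ennreal (measure m A0 powr (1 / N)))"
            using q c t by (simp add: mult.assoc flip: ennreal_mult')
          \<comment> \<open>The term of the endpoint \<open>A1\<close> is nonnegative and is added
            for free.\<close>
          also have "\<dots> \<le> ennreal q * (tau_coeff K N (1 - t) (dist x y) * ennreal (measure m A0 powr (1 / N))
           + tau_coeff K N t (dist x y) * ennreal (measure m A1 powr (1 / N)))"
            using c(2)[of "1 - t" "dist x y"] t D[OF that]
            by (intro mult_left_mono order_trans[OF mult_right_mono[of "ennreal (c * (1 - t))" "tau_coeff K N (1 - t) (dist x y)"]]) auto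
          finally show ?thesis by (simp add: q_def)
        qed
        then show "emeasure (distr \<pi> borel (ev t)) E
            \<le> ennreal ((q * c * (1 - t) * measure m A0 powr (1 / N)) powr (- N)) * emeasure m E"
          using A \<pi> t E q c pos by (intro interpolation_density_bound) auto
        have "ennreal (q * c * t * measure m A1 powr (1 / N)) \<le> ennreal (Q powr (- 1 / N)) *
            (tau_coeff K N (1 - t) (dist x y) * ennreal (measure m A0 powr (1 / N))
           + tau_coeff K N t (dist x y) * ennreal (measure m A1 powr (1 / N)))"
          if "x \<in> A0" "y \<in> A1" for x y
        proof -
          have "ennreal (q * c * t * measure m A1 powr (1 / N)) =
            ennreal q * (ennreal (c * t) * ennreal (measure m A1 powr (1 / N)))"
            using q c t by (simp add: mult.assoc flip: ennreal_mult')
          \<comment> \<open>Now the term of the endpoint \<open>A0\<close> is the one added.\<close>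
          also have "\<dots> \<le> ennreal q * (tau_coeff K N (1 - t) (dist x y) * ennreal (measure m A0 powr (1 / N))
           + tau_coeff K N t (dist x y) * ennreal (measure m A1 powr (1 / N)))"
            using c(2)[of t "dist x y"] t D[OF that]
            by (intro mult_left_mono order_trans[OF mult_right_mono[of "ennreal (c * t)" "tau_coeff K N t (dist x y)"]]) auto
          finally show ?thesis by (simp add: q_def)
        qed
        then show "emeasure (distr \<pi> borel (ev t)) E
            \<le> ennreal ((q * c * t * measure m A1 powr (1 / N)) powr (- N)) * emeasure m E"
          using A \<pi> t E q c pos by (intro interpolation_density_bound) auto
      qed
      with \<pi> have "\<pi> \<in> controlled_plans (q * c) A0 A1"
        unfolding controlled_plans_def by auto
      then show "controlled_plans (q * c) A0 A1 \<noteq> {}" by blast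
    qed
  qed
qed

end

section \<open>The slope as an upper gradient along geodesics\<close>

text \<open>Reverse Fatou for the difference quotients replaces the almost everywhere differentiability of
  Lipschitz functions.\<close>

lemma abs_diff_le_nn_integral_limsup_quotients:
  fixes \<phi> :: "real \<Rightarrow> real"
  assumes L: "L-lipschitz_on UNIV \<phi>"
  shows "ennreal \<bar>\<phi> 1 - \<phi> 0\<bar>
    \<le> (\<integral>\<^sup>+ t\<in>{0..1}. limsup (\<lambda>n. ennreal (\<bar>\<phi> (t + 1 / Suc n) - \<phi> t\<bar> * Suc n)) \<partial>lborel)"
proof -
  have cont: "continuous_on S \<phi>" for S
    using lipschitz_on_continuous_on[OF L] continuous_on_subset by blast
  then have [measurable]: "\<phi> \<in> borel_measurable borel"
    by (intro borel_measurable_continuous_onI)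
  \<comment> \<open>The interval is large enough that \<open>x\<close> and
    \<open>x + 1 / Suc n\<close> are interior points for all \<open>x\<close> in
    \<open>[0, 1]\<close>, so \<open>F\<close> has two-sided derivatives there.\<close>
  obtain F where F: "\<And>x. x \<in> {-1..3} \<Longrightarrow> (F has_vector_derivative \<phi> x) (at x within {-1..3})"
    using antiderivative_continuous[OF cont[of "{-1..3}"]] by blast
  have F': "(F has_real_derivative \<phi> x) (at x)" if "x \<in> {-1<..<3}" for x
    using F[of x] that at_within_Icc_at[of "-1" x 3]
    by (simp add: has_real_derivative_iff_has_vector_derivative)
  define q where "q n t = (\<phi> (t + 1 / Suc n) - \<phi> t) * Suc n" for n :: nat and t :: real
  have [measurable]: "q n \<in> borel_measurable borel" for n
    unfolding q_def by measurable
  \<comment> \<open>\<open>G n\<close> is the integral of \<open>q n\<close> over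
    \<open>[0, 1]\<close>: the difference quotient of \<open>F\<close> with step
    \<open>1 / Suc n\<close> is an antiderivative of \<open>q n\<close>.\<close>
  define G where "G n = (F (1 + 1 / Suc n) - F 1) * Suc n - (F (0 + 1 / Suc n) - F 0) * Suc n" for n :: nat
  have "ennreal \<bar>G n\<bar> \<le> (\<integral>\<^sup>+ t\<in>{0..1}. ennreal \<bar>q n t\<bar> \<partial>lborel)" for n
  proof -
    have h: "0 < 1 / real (Suc n)" "1 / real (Suc n) \<le> 1" by auto
    have "has_bochner_integral lborel (\<lambda>t. indicator {0..1} t *\<^sub>R q n t)
        ((F (1 + 1 / Suc n) - F 1) * Suc n - (F (0 + 1 / Suc n) - F 0) * Suc n)"
    proof (rule has_bochner_integral_FTC_Icc)
      fix x :: real assume x: "0 \<le> x" "x \<le> 1"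
      have xh: "x + 1 / real (Suc n) \<in> {-1<..<3}"
        using x h unfolding greaterThanLessThan_iff by linarith
      have "((\<lambda>x. (F (x + 1 / Suc n) - F x) * Suc n) has_real_derivative q n x) (at x)"
        unfolding q_def using x xh
        by (intro DERIV_cmult_right DERIV_diff F' DERIV_shift[THEN iffD1]) auto
      then show "((\<lambda>x. (F (x + 1 / Suc n) - F x) * Suc n) has_vector_derivative q n x) (at x within {0..1})"
        by (metis has_real_derivative_iff_has_vector_derivative has_vector_derivative_at_within)
    next
      show "continuous_on {0..1} (q n)"
        unfolding q_def by (intro continuous_intros continuous_on_compose2[OF cont[of UNIV]]) auto
    qed auto
    then have "integrable lborel (\<lambda>t. indicator {0..1} t *\<^sub>R q n t)"
      "(\<integral>t. indicator {0..1} t *\<^sub>R q n t \<partial>lborel) = G n"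
      unfolding has_bochner_integral_iff G_def by auto
    then have "ennreal (norm (G n)) \<le> (\<integral>\<^sup>+ t. ennreal (norm (indicator {0..1} t *\<^sub>R q n t)) \<partial>lborel)"
      using integral_norm_bound_ennreal by metis
    also have "\<dots> = (\<integral>\<^sup>+ t\<in>{0..1}. ennreal \<bar>q n t\<bar> \<partial>lborel)"
      by (intro nn_integral_cong) (auto split: split_indicator)
    finally show ?thesis by simp
  qed
  then have "limsup (\<lambda>n. ennreal \<bar>G n\<bar>) \<le> limsup (\<lambda>n. \<integral>\<^sup>+ t\<in>{0..1}. ennreal \<bar>q n t\<bar> \<partial>lborel)"
    by (intro Limsup_mono) simp
  also have "\<dots> \<le> (\<integral>\<^sup>+ t. limsup (\<lambda>n. ennreal \<bar>q n t\<bar> * indicator {0..1} t) \<partial>lborel)"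
  proof (rule nn_integral_limsup)
    \<comment> \<open>The Lipschitz constant supplies the integrable majorant for reverse
      Fatou.\<close>
    have "\<bar>q n t\<bar> \<le> L" for n t
    proof -
      have "\<bar>q n t\<bar> = dist (\<phi> (t + 1 / Suc n)) (\<phi> t) * Suc n"
        by (simp add: q_def dist_real_def abs_mult)
      also have "\<dots> \<le> L * dist (t + 1 / Suc n) t * Suc n"
        using lipschitz_onD[OF L, of "t + 1 / Suc n" t] by (intro mult_right_mono) auto
      also have "\<dots> = L" by (simp add: dist_real_def)
      finally show ?thesis .
    qed
    then show "AE t in lborel. ennreal \<bar>q n t\<bar> * indicator {0..1} t \<le> ennreal L * indicator {0..1} t" for n
      by (intro AE_I2) (auto intro: ennreal_leI split: split_indicator)
    show "(\<integral>\<^sup>+ t. ennreal L * indicator {0..1::real} t \<partial>lborel) < \<infinity>"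
      by (subst nn_integral_cmult_indicator) (auto simp: ennreal_mult_less_top)
  qed simp_all
  also have "\<dots> = (\<integral>\<^sup>+ t\<in>{0..1}. limsup (\<lambda>n. ennreal (\<bar>\<phi> (t + 1 / Suc n) - \<phi> t\<bar> * Suc n)) \<partial>lborel)"
    by (intro nn_integral_cong) (auto simp: q_def abs_mult Limsup_const split: split_indicator)
  finally have le: "limsup (\<lambda>n. ennreal \<bar>G n\<bar>) \<le> \<dots>" .
  have "filterlim (\<lambda>n. 1 / real (Suc n)) (at 0) sequentially"
    using LIMSEQ_inverse_real_of_nat by (auto simp: filterlim_at inverse_eq_divide)
  then have quot: "(\<lambda>n. (F (x + 1 / Suc n) - F x) * Suc n) \<longlonglongrightarrow> \<phi> x" if "x \<in> {-1<..<3}" for x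
    using filterlim_compose[OF F'[OF that, unfolded DERIV_def]] by (fastforce simp: field_simps)
  \<comment> \<open>\<open>G n\<close> is a difference of difference quotients of \<open>F\<close>
    at 1 and at 0.\<close>
  have "G \<longlonglongrightarrow> \<phi> 1 - \<phi> 0"
    unfolding G_def by (intro tendsto_diff quot) auto
  then have "(\<lambda>n. ennreal \<bar>G n\<bar>) \<longlonglongrightarrow> ennreal \<bar>\<phi> 1 - \<phi> 0\<bar>"
    by (intro tendsto_ennrealI tendsto_rabs)
  from lim_imp_Limsup[OF _ this] le show ?thesis by simp
qed

section \<open>The upper gradient inequality along constant-speed geodesics\<close>

lemma GeoD:
  "\<gamma> \<in> Geo \<Longrightarrow> s \<in> {0..1} \<Longrightarrow> t \<in> {0..1} \<Longrightarrow>
    dist (ev s \<gamma>) (ev t \<gamma>) = \<bar>s - t\<bar> * dist (ev 0 \<gamma>) (ev 1 \<gamma>)"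
  unfolding Geo_def by blast

lemma continuous_ev_time:
  fixes \<gamma> :: "'a::metric_space curve"
  assumes "\<gamma> \<in> Geo"
  shows "continuous_on {0..1} (\<lambda>t. ev t \<gamma>)"
proof -
  have "(dist (ev 0 \<gamma>) (ev 1 \<gamma>))-lipschitz_on {0..1} (\<lambda>t. ev t \<gamma>)"
    using GeoD[OF assms] by (intro lipschitz_onI) (simp_all only: dist_real_def mult.commute zero_le_dist order_refl)
  then show ?thesis by (rule lipschitz_on_continuous_on)
qed

text \<open>An upper limit along a sequence is at most the full upper limit at \<open>x\<close>. The
  two conventions in \<open>slope\<close> do no harm: the sequence shows that \<open>x\<close> is
  not isolated, and the Lipschitz bound keeps the upper limit finite under
  \<open>enn2real\<close>.\<close>

lemma limsup_quotients_le_slope: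
  fixes u :: "'a::metric_space \<Rightarrow> real"
  assumes L: "L-lipschitz_on UNIV u" and y: "y \<longlonglongrightarrow> x" "\<And>n. y n \<noteq> x"
  shows "limsup (\<lambda>n. ennreal (\<bar>u (y n) - u x\<bar> / dist x (y n))) \<le> ennreal (slope u x)"
proof -
  let ?q = "\<lambda>z. ennreal (\<bar>u z - u x\<bar> / dist x z)"
  have lim: "filterlim y (at x) sequentially"
    using y by (auto simp: filterlim_at)
  have nopen: "\<not> open {x}"
  proof
    assume "open {x}"
    then have "eventually (\<lambda>n. y n \<in> {x}) sequentially"
      using y(1) by (intro topological_tendstoD) auto
    then show False using y(2) by simp
  qed
  have "?q z \<le> ennreal L" for z
  proof (cases "z = x")
    case False
    then show ?thesis
      using lipschitz_onD[OF L, of z x] by (auto simp: dist_real_def dist_commute field_simps intro!: ennreal_leI)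
  qed (use lipschitz_on_nonneg[OF L] in simp)
  then have "Limsup (at x) ?q \<le> ennreal L"
    by (intro Limsup_bounded) auto
  then have "Limsup (at x) ?q < top"
    using ennreal_less_top le_less_trans by blast
  then have "ennreal (slope u x) = Limsup (at x) ?q"
    using nopen by (simp add: slope_def)
  moreover have "limsup (\<lambda>n. ?q (y n)) \<le> Limsup (at x) ?q"
    unfolding Limsup_le_iff
  proof (intro allI impI)
    fix z assume "Limsup (at x) ?q < z"
    then have "eventually (\<lambda>w. ?q w < z) (at x)"
      by (rule Limsup_lessD)
    then show "eventually (\<lambda>n. ?q (y n) < z) sequentially"
      using lim by (rule eventually_compose_filterlim)
  qed
  ultimately show ?thesis by simp
qed

text \<open>Restricting \<open>u\<close> to the geodesic reduces the claim to a Lipschitz function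
  of one real variable, whose difference quotients are, up to the constant speed, those of
  \<open>u\<close> between points of the curve.\<close>

lemma slope_upper_gradient:
  fixes u :: "'a::metric_space \<Rightarrow> real"
  assumes L: "L-lipschitz_on UNIV u" and \<gamma>: "\<gamma> \<in> Geo"
  shows "ennreal \<bar>u (ev 0 \<gamma>) - u (ev 1 \<gamma>)\<bar>
    \<le> ennreal (dist (ev 0 \<gamma>) (ev 1 \<gamma>)) * (\<integral>\<^sup>+ t\<in>{0..1}. ennreal (slope u (ev t \<gamma>)) \<partial>lborel)"
proof (cases "ev 0 \<gamma> = ev 1 \<gamma>")
  case False
  define d where "d = dist (ev 0 \<gamma>) (ev 1 \<gamma>)"
  have d: "d > 0" using False by (simp add: d_def)
  have geo: "dist (ev s \<gamma>) (ev t \<gamma>) = \<bar>s - t\<bar> * d" if "s \<in> {0..1}" "t \<in> {0..1}" for s t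
    unfolding d_def using \<gamma> that by (rule GeoD)
  \<comment> \<open>Clamping the time makes the composed function Lipschitz on the whole
    line.\<close>
  define c where "c t = max 0 (min t 1)" for t :: real
  have c: "c t \<in> {0..1}" "\<bar>c s - c t\<bar> \<le> \<bar>s - t\<bar>" for s t by (auto simp: c_def)
  \<comment> \<open>Dividing by the speed \<open>d\<close> turns quotients over time differences
    into quotients over distances, the form occurring in \<open>slope\<close>.\<close>
  define \<phi> where "\<phi> t = u (ev (c t) \<gamma>) / d" for t
  have "L-lipschitz_on UNIV \<phi>"
  proof (rule lipschitz_onI)
    fix s t :: real
    have "dist (\<phi> s) (\<phi> t) = dist (u (ev (c s) \<gamma>)) (u (ev (c t) \<gamma>)) / d"
      using d by (simp add: \<phi>_def dist_real_def flip: diff_divide_distrib)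
    also have "\<dots> \<le> L * (\<bar>c s - c t\<bar> * d) / d"
      using lipschitz_onD[OF L, of "ev (c s) \<gamma>" "ev (c t) \<gamma>"] geo[OF c(1) c(1)] d
      by (intro divide_right_mono) auto
    also have "\<dots> = L * \<bar>c s - c t\<bar>" using d by simp
    also have "\<dots> \<le> L * dist s t"
      using c(2)[of s t] lipschitz_on_nonneg[OF L] by (intro mult_left_mono) (auto simp: dist_real_def)
    finally show "dist (\<phi> s) (\<phi> t) \<le> L * dist s t" .
  qed (rule lipschitz_on_nonneg[OF L])
  from abs_diff_le_nn_integral_limsup_quotients[OF this]
  have "ennreal \<bar>\<phi> 1 - \<phi> 0\<bar> \<le> (\<integral>\<^sup>+ t\<in>{0..1}. limsup (\<lambda>n. ennreal (\<bar>\<phi> (t + 1 / Suc n) - \<phi> t\<bar> * Suc n)) \<partial>lborel)" .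
  also have "\<dots> \<le> (\<integral>\<^sup>+ t\<in>{0..1}. ennreal (slope u (ev t \<gamma>)) \<partial>lborel)"
  proof (rule nn_integral_mono_AE)
    have "limsup (\<lambda>n. ennreal (\<bar>\<phi> (t + 1 / Suc n) - \<phi> t\<bar> * Suc n)) \<le> ennreal (slope u (ev t \<gamma>))"
      if t: "t \<in> {0..<1}" for t
    proof -
      have lim: "(\<lambda>n. t + 1 / Suc n) \<longlonglongrightarrow> t + 0"
        using LIMSEQ_inverse_real_of_nat by (intro tendsto_intros) (simp add: inverse_eq_divide)
      then have "eventually (\<lambda>n. t + 1 / Suc n < 1) sequentially"
        using t by (intro order_tendstoD) auto
      \<comment> \<open>Shifting the index by \<open>n0\<close> keeps all times inside
        \<open>[0, 1]\<close>, where clamping has no effect. The time \<open>t = 1\<close> has no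
        room on the right and is discarded as a null set.\<close>
      then obtain n0 where n0: "\<And>n. n \<ge> n0 \<Longrightarrow> t + 1 / Suc n < 1"
        by (auto simp: eventually_sequentially)
      define s where "s n = t + 1 / Suc (n + n0)" for n
      have s: "s n \<in> {0..1}" "s n - t = 1 / Suc (n + n0)" for n
        using t n0[of "n + n0"] by (auto simp: s_def)
      have "s \<longlonglongrightarrow> t"
        using LIMSEQ_ignore_initial_segment[OF lim, of n0] by (simp add: s_def[abs_def])
      have dist_s: "dist (ev t \<gamma>) (ev (s n) \<gamma>) = d / Suc (n + n0)" for n
      proof -
        have "\<bar>t - s n\<bar> = 1 / Suc (n + n0)"
          by (subst abs_minus_commute) (simp add: s(2))
        then show ?thesis using geo[of t "s n"] t s(1)[of n] by simp
      qed
      have "(\<lambda>n. ev (s n) \<gamma>) \<longlonglongrightarrow> ev t \<gamma>"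
        using continuous_on_tendsto_compose[OF continuous_ev_time[OF \<gamma>] \<open>s \<longlonglongrightarrow> t\<close>] t s by auto
      moreover have "ev (s n) \<gamma> \<noteq> ev t \<gamma>" for n
        using dist_s[of n] d by auto
      ultimately have *: "limsup (\<lambda>n. ennreal (\<bar>u (ev (s n) \<gamma>) - u (ev t \<gamma>)\<bar> / dist (ev t \<gamma>) (ev (s n) \<gamma>)))
          \<le> ennreal (slope u (ev t \<gamma>))"
        by (rule limsup_quotients_le_slope[OF L])
      have "\<bar>\<phi> (s n) - \<phi> t\<bar> * Suc (n + n0) = \<bar>u (ev (s n) \<gamma>) - u (ev t \<gamma>)\<bar> / dist (ev t \<gamma>) (ev (s n) \<gamma>)" for n
      proof -
        have "c (s n) = s n" "c t = t" using s(1)[of n] t by (auto simp: c_def)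
        then show ?thesis
          using d by (simp add: \<phi>_def dist_s flip: diff_divide_distrib)
      qed
      then have "limsup (\<lambda>n. ennreal (\<bar>\<phi> (t + 1 / Suc (n + n0)) - \<phi> t\<bar> * Suc (n + n0)))
          \<le> ennreal (slope u (ev t \<gamma>))"
        using * by (simp add: s_def)
      then show ?thesis
        by (subst (asm) limsup_shift_k)
    qed
    moreover have "AE t in lborel. t \<noteq> (1::real)"
      by (rule AE_lborel_singleton)
    ultimately show "AE t in lborel. limsup (\<lambda>n. ennreal (\<bar>\<phi> (t + 1 / Suc n) - \<phi> t\<bar> * Suc n)) * indicator {0..1} t
        \<le> ennreal (slope u (ev t \<gamma>)) * indicator {0..1} t"
      by (auto elim!: eventually_mono split: split_indicator)
  qed
  finally have "ennreal d * ennreal \<bar>\<phi> 1 - \<phi> 0\<bar> \<le> ennreal d * (\<integral>\<^sup>+ t\<in>{0..1}. ennreal (slope u (ev t \<gamma>)) \<partial>lborel)"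
    by (rule mult_left_mono) simp
  moreover have "d * \<bar>\<phi> 1 - \<phi> 0\<bar> = \<bar>u (ev 0 \<gamma>) - u (ev 1 \<gamma>)\<bar>"
    using d by (simp add: \<phi>_def c_def abs_minus_commute flip: diff_divide_distrib)
  ultimately show ?thesis
    using d by (simp add: d_def flip: ennreal_mult)
qed simp

section \<open>Compactness of closed balls\<close>

text \<open>An \<open>e\<close>-separated subset of maximal cardinality is an \<open>e\<close>-net:
  an uncovered point could be added to it.\<close>

lemma finite_cover_of_separated_card_le:
  fixes X :: "'a::metric_space set"
  assumes e: "e > 0" and n: "\<And>S. finite S \<Longrightarrow> S \<subseteq> X \<Longrightarrow> (\<And>x y. x \<in> S \<Longrightarrow> y \<in> S \<Longrightarrow> x \<noteq> y \<Longrightarrow> e \<le> dist x y) \<Longrightarrow> card S \<le> n"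
  obtains S where "finite S" "X \<subseteq> (\<Union>x\<in>S. ball x e)"
proof -
  define P where "P k \<longleftrightarrow> (\<exists>S. finite S \<and> S \<subseteq> X \<and> (\<forall>x\<in>S. \<forall>y\<in>S. x \<noteq> y \<longrightarrow> e \<le> dist x y) \<and> card S = k)" for k
  have P0: "P 0" unfolding P_def by (intro exI[of _ "{}"]) auto
  have bound: "k \<le> n" if "P k" for k
  proof -
    obtain S where "finite S" "S \<subseteq> X" "\<forall>x\<in>S. \<forall>y\<in>S. x \<noteq> y \<longrightarrow> e \<le> dist x y" "card S = k"
      using \<open>P k\<close> unfolding P_def by blast
    then show ?thesis using n[of S] by simp
  qed
  define k where "k = Greatest P"
  have k: "P k" unfolding k_def using P0 bound by (rule GreatestI_nat)
  have max: "k' \<le> k" if "P k'" for k' unfolding k_def using that bound by (rule Greatest_le_nat)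
  from k obtain S where S: "finite S" "S \<subseteq> X" "\<And>x y. x \<in> S \<Longrightarrow> y \<in> S \<Longrightarrow> x \<noteq> y \<Longrightarrow> e \<le> dist x y" "card S = k"
    unfolding P_def by blast
  have "X \<subseteq> (\<Union>x\<in>S. ball x e)"
  proof
    fix z assume z: "z \<in> X"
    show "z \<in> (\<Union>x\<in>S. ball x e)"
    proof (rule ccontr)
      assume "z \<notin> (\<Union>x\<in>S. ball x e)"
      then have far: "e \<le> dist x z" if "x \<in> S" for x using that by (auto simp: not_less)
      then have "z \<notin> S" using e by force
      have "P (Suc k)" unfolding P_def
        using S z far \<open>z \<notin> S\<close> by (intro exI[of _ "insert z S"]) (auto simp: dist_commute)
      then show False using max[of "Suc k"] by simp
    qed
  qed
  with S(1) show thesis by (rule that)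
qed

section \<open>Lower volume bounds for balls, and total boundedness\<close>

context qcd_space
begin

lemma AE_OptGeo_uniform:
  assumes "compact A0" "compact A1"
    and \<pi>: "\<pi> \<in> OptGeo (uniform_measure m A0) (uniform_measure m A1)"
  shows "AE \<gamma> in \<pi>. \<gamma> \<in> Geo \<and> ev 0 \<gamma> \<in> A0 \<and> ev 1 \<gamma> \<in> A1"
proof -
  have [measurable_cong]: "sets \<pi> = sets borel"
    and d: "distr \<pi> borel (ev 0) = uniform_measure m A0" "distr \<pi> borel (ev 1) = uniform_measure m A1"
    and geo: "AE \<gamma> in \<pi>. \<gamma> \<in> Geo"
    using \<pi> by (auto simp: OptGeo_def borel_measure_def)
  have "AE \<gamma> in \<pi>. ev 0 \<gamma> \<in> A0"
    using AE_uniform_mem[OF assms(1)] unfolding d[symmetric] by (rule AE_distrD[rotated]) measurable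
  moreover have "AE \<gamma> in \<pi>. ev 1 \<gamma> \<in> A1"
    using AE_uniform_mem[OF assms(2)] unfolding d[symmetric] by (rule AE_distrD[rotated]) measurable
  ultimately show ?thesis using geo by auto
qed

lemma emeasure_distr_eq_1:
  assumes "\<pi> \<in> OptGeo \<mu>0 \<mu>1" "E \<in> sets borel" "AE \<gamma> in \<pi>. ev t \<gamma> \<in> E"
  shows "emeasure (distr \<pi> borel (ev t)) E = 1"
proof -
  have [measurable_cong]: "sets \<pi> = sets borel" and "prob_space \<pi>"
    using assms by (auto simp: OptGeo_def borel_measure_def)
  interpret prob_space \<pi> by fact
  interpret D: prob_space "distr \<pi> borel (ev t)" by (rule prob_space_distr) measurable
  have "AE x in distr \<pi> borel (ev t). x \<in> E"
    using assms by (subst AE_distr_iff) auto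
  then show ?thesis using assms by (intro D.emeasure_eq_1_AE) auto
qed

text \<open>A fixed set of positive measure is transported to a neighbourhood of \<open>x\<close>; just before the
  final time the transported mass sits in \<open>ball x e\<close> and its density is controlled by the initial one.\<close>

lemma emeasure_ball_ge:
  fixes x0 :: 'a
  assumes e: "e > 0"
  obtains C where "\<And>x. x \<in> cball x0 R \<Longrightarrow> 1 \<le> ennreal C * emeasure m (ball x e)"
proof (cases "R < 0")
  case True
  then have "cball x0 R = {}" by simp
  then show thesis using that[of 0] by simp
next
  case False
  then have R: "R \<ge> 0" by simp
  have "emeasure m (ball x0 1) > 0" by (rule emeasure_open_pos[of _ x0]) auto
  \<comment> \<open>The starting set is chosen before \<open>x\<close>; together with a constant
    \<open>c\<close> depending only on \<open>D\<close>, this makes the final bound uniform in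
    \<open>x\<close>.\<close>
  then obtain A0 where A0: "compact A0" "A0 \<subseteq> ball x0 1" "emeasure m A0 > 0"
    by (rule inner_compact[rotated]) auto
  define D where "D = 1 + R + e"
  have D: "D > 0" using R e by (simp add: D_def)
  obtain c where c: "c > 0"
    "\<forall>A0 A1. compact A0 \<and> compact A1 \<and> emeasure m A0 > 0 \<and> emeasure m A1 > 0 \<and>
      (\<forall>x\<in>A0. \<forall>y\<in>A1. dist x y \<le> D) \<longrightarrow> controlled_plans c A0 A1 \<noteq> {}"
    by (rule controlled_plans_nonempty)
  \<comment> \<open>The time is so close to 1 that a geodesic of length at most \<open>D\<close> has
    at most \<open>e / 2\<close> left to travel; its endpoint lies within \<open>e / 2\<close> of
    \<open>x\<close>.\<close>
  define t where "t = D / (D + e / 2)"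
  have t: "0 < t" "t < 1" using D e by (auto simp: t_def)
  have "(1 - t) * D = e / 2 * t" using D e by (simp add: t_def field_simps)
  also have "\<dots> \<le> e / 2 * 1" using e t by (intro mult_left_mono) auto
  finally have tD: "(1 - t) * D \<le> e / 2" by simp
  show thesis
  proof (rule that)
    fix x assume x: "x \<in> cball x0 R"
    have "emeasure m (ball x (e / 2)) > 0" using e by (intro emeasure_open_pos[of _ x]) auto
    then obtain A1 where A1: "compact A1" "A1 \<subseteq> ball x (e / 2)" "emeasure m A1 > 0"
      by (rule inner_compact[rotated]) auto
    have dist: "dist y z \<le> D" if "y \<in> A0" "z \<in> A1" for y z
    proof -
      have "dist x0 y < 1" "dist x0 x \<le> R" "dist x z < e / 2" using that A0 A1 x by auto
      then show ?thesis
        using dist_triangle[of y z x0] dist_triangle[of x0 z x] e unfolding D_def dist_commute[of y x0] by linarith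
    qed
    obtain \<pi> where \<pi>: "\<pi> \<in> OptGeo (uniform_measure m A0) (uniform_measure m A1)"
      and le: "\<And>E. E \<in> sets borel \<Longrightarrow> emeasure (distr \<pi> borel (ev t)) E
          \<le> ennreal ((c * (1 - t) * measure m A0 powr (1 / N)) powr (- N)) * emeasure m E"
    proof -
      have "controlled_plans c A0 A1 \<noteq> {}"
        using A0 A1 dist by (intro c(2)[THEN spec, THEN spec, THEN mp] conjI ballI)
      then obtain \<pi> where "\<pi> \<in> controlled_plans c A0 A1" by blast
      with t show thesis
        unfolding controlled_plans_def by (intro that[of \<pi>]) simp_all
    qed
    have "AE \<gamma> in \<pi>. ev t \<gamma> \<in> ball x e"
      using AE_OptGeo_uniform[OF A0(1) A1(1) \<pi>]
    proof eventually_elim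
      case (elim \<gamma>)
      have "dist (ev t \<gamma>) (ev 1 \<gamma>) = (1 - t) * dist (ev 0 \<gamma>) (ev 1 \<gamma>)"
        using GeoD[of \<gamma> t 1] elim t by simp
      also have "\<dots> \<le> (1 - t) * D"
        using dist elim t by (intro mult_left_mono) auto
      also note tD
      finally have "dist (ev t \<gamma>) (ev 1 \<gamma>) \<le> e / 2" .
      moreover have "dist x (ev 1 \<gamma>) < e / 2" using elim A1 by auto
      ultimately show ?case
        using dist_triangle[of x "ev t \<gamma>" "ev 1 \<gamma>"] by (simp add: dist_commute)
    qed
    then have "emeasure (distr \<pi> borel (ev t)) (ball x e) = 1"
      using \<pi> by (intro emeasure_distr_eq_1) auto
    with le[of "ball x e"]
    show "1 \<le> ennreal ((c * (1 - t) * measure m A0 powr (1 / N)) powr (- N)) * emeasure m (ball x e)"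
      by simp
  qed
qed

text \<open>A packing argument. The balls of radius \<open>e / 2\<close> around
  \<open>e\<close>-separated points are disjoint, lie in a ball of finite measure, and each has
  measure bounded below by \<open>emeasure_ball_ge\<close>. So their number is bounded, the closed
  ball is totally bounded, and completeness gives compactness.\<close>

lemma compact_cball: "compact (cball (x0::'a) R)"
  unfolding compact_eq_totally_bounded
proof (intro conjI allI impI)
  show "complete (cball x0 R)" by (simp add: complete_eq_closed)
  fix e :: real assume e: "e > 0"
  obtain C where C: "\<And>x. x \<in> cball x0 R \<Longrightarrow> 1 \<le> ennreal C * emeasure m (ball x (e / 2))"
    using emeasure_ball_ge[of "e / 2" x0 R] e by auto
  define b where "b = ennreal C * emeasure m (cball x0 (R + e))"
  have "b < \<infinity>"
    using emeasure_bounded[of "cball x0 (R + e)"] by (simp add: b_def ennreal_mult_less_top)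
  then obtain n where n: "b < of_nat n"
    using ennreal_Ex_less_of_nat[of b] by auto
  obtain S where "finite S" "cball x0 R \<subseteq> (\<Union>x\<in>S. ball x e)"
  proof (rule finite_cover_of_separated_card_le[OF e, of "cball x0 R" n])
    fix S assume S: "finite S" "S \<subseteq> cball x0 R" "\<And>x y. x \<in> S \<Longrightarrow> y \<in> S \<Longrightarrow> x \<noteq> y \<Longrightarrow> e \<le> dist x y"
    have "disjoint_family_on (\<lambda>x. ball x (e / 2)) S"
      unfolding disjoint_family_on_def
    proof (intro ballI impI)
      fix x y assume "x \<in> S" "y \<in> S" "x \<noteq> y"
      from S(3)[OF this] show "ball x (e / 2) \<inter> ball y (e / 2) = {}"
        by (intro disjoint_ballI) simp
    qed
    then have eq: "emeasure m (\<Union>x\<in>S. ball x (e / 2)) = (\<Sum>x\<in>S. emeasure m (ball x (e / 2)))"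
      using S(1) by (intro sum_emeasure[symmetric]) auto
    have sub: "(\<Union>x\<in>S. ball x (e / 2)) \<subseteq> cball x0 (R + e)"
    proof safe
      fix x y assume "x \<in> S" "y \<in> ball x (e / 2)"
      moreover from this have "dist x0 x \<le> R" using S(2) by auto
      ultimately show "y \<in> cball x0 (R + e)"
        using dist_triangle[of x0 y x] e by simp
    qed
    have "of_nat (card S) = (\<Sum>x\<in>S. 1::ennreal)" by simp
    also have "\<dots> \<le> (\<Sum>x\<in>S. ennreal C * emeasure m (ball x (e / 2)))"
      using C S(2) by (intro sum_mono) blast
    also have "\<dots> = ennreal C * emeasure m (\<Union>x\<in>S. ball x (e / 2))"
      by (simp add: eq sum_distrib_left)
    also have "\<dots> \<le> b"
      unfolding b_def using sub by (intro mult_left_mono emeasure_mono) auto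
    also note n
    finally show "card S \<le> n" by simp
  qed
  then show "\<exists>S. finite S \<and> cball x0 R \<subseteq> (\<Union>x\<in>S. ball x e)" by blast
qed

end

section \<open>Weak convergence against dominated measures\<close>

lemma L2_mult_integrable:
  assumes "f \<in> L2 m" "g \<in> L2 m"
  shows "integrable m (\<lambda>x. f x * g x)"
proof (rule Bochner_Integration.integrable_bound)
  show "integrable m (\<lambda>x. (f x)\<^sup>2 + (g x)\<^sup>2)" using assms by (auto simp: L2_def)
  show "(\<lambda>x. f x * g x) \<in> borel_measurable m" using assms by (auto simp: L2_def)
  have "\<bar>a * b\<bar> \<le> a\<^sup>2 + b\<^sup>2" for a b :: real
  proof -
    have "2 * \<bar>a * b\<bar> \<le> a\<^sup>2 + b\<^sup>2"
      using sum_squares_bound[of "\<bar>a\<bar>" "\<bar>b\<bar>"] by (simp add: abs_mult mult.assoc)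
    then show ?thesis by linarith
  qed
  then show "AE x in m. norm (f x * g x) \<le> norm ((f x)\<^sup>2 + (g x)\<^sup>2)" by simp
qed

lemma L2_diff:
  assumes "f \<in> L2 m" "g \<in> L2 m"
  shows "(\<lambda>x. f x - g x) \<in> L2 m"
proof -
  have "integrable m (\<lambda>x. (f x)\<^sup>2 + (g x)\<^sup>2 - 2 * (f x * g x))"
    using assms L2_mult_integrable[OF assms] by (auto simp: L2_def)
  then have "integrable m (\<lambda>x. (f x - g x)\<^sup>2)"
    by (simp add: power2_diff algebra_simps)
  then show ?thesis using assms by (auto simp: L2_def)
qed

lemma L2_Cauchy_Schwarz:
  assumes "f \<in> L2 m" "g \<in> L2 m"
  shows "\<bar>\<integral>x. f x * g x \<partial>m\<bar> \<le> L2_norm m f * L2_norm m g"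
proof -
  have [measurable]: "f \<in> borel_measurable m" "g \<in> borel_measurable m"
    using assms by (auto simp: L2_def)
  have sq: "(\<integral>\<^sup>+ x. (ennreal \<bar>k x\<bar>)\<^sup>2 \<partial>m) = ennreal ((L2_norm m k)\<^sup>2)" if "k \<in> L2 m" for k
  proof -
    have "(\<integral>\<^sup>+ x. (ennreal \<bar>k x\<bar>)\<^sup>2 \<partial>m) = (\<integral>\<^sup>+ x. ennreal ((k x)\<^sup>2) \<partial>m)"
      by (simp add: ennreal_power)
    also have "\<dots> = ennreal (\<integral>x. (k x)\<^sup>2 \<partial>m)"
      using that by (intro nn_integral_eq_integral) (auto simp: L2_def)
    finally show ?thesis by (simp add: L2_norm_def)
  qed
  have "(ennreal \<bar>\<integral>x. f x * g x \<partial>m\<bar>)\<^sup>2 \<le> (\<integral>\<^sup>+ x. ennreal \<bar>f x\<bar> * ennreal \<bar>g x\<bar> \<partial>m)\<^sup>2"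
    using integral_norm_bound_ennreal[OF L2_mult_integrable[OF assms]]
    by (intro power_mono) (simp_all add: abs_mult ennreal_mult)
  also have "\<dots> \<le> (\<integral>\<^sup>+ x. (ennreal \<bar>f x\<bar>)\<^sup>2 \<partial>m) * (\<integral>\<^sup>+ x. (ennreal \<bar>g x\<bar>)\<^sup>2 \<partial>m)"
    by (rule Cauchy_Schwarz_nn_integral) measurable
  also have "\<dots> = ennreal ((L2_norm m f * L2_norm m g)\<^sup>2)"
    using assms by (simp add: sq power_mult_distrib ennreal_mult)
  finally have "\<bar>\<integral>x. f x * g x \<partial>m\<bar>\<^sup>2 \<le> (L2_norm m f * L2_norm m g)\<^sup>2"
    by (simp add: ennreal_power)
  then show ?thesis
    by (rule power2_le_imp_le) (simp add: L2_norm_def)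
qed

lemma L2_tendsto_imp_weak:
  assumes "L2_tendsto m u f"
  shows "L2_weak_tendsto m u f"
  unfolding L2_weak_tendsto_def
proof (intro conjI ballI)
  show u: "\<forall>n. u n \<in> L2 m" and f: "f \<in> L2 m" using assms by (auto simp: L2_tendsto_def)
  fix h assume h: "h \<in> L2 m"
  have "(\<lambda>n. (\<integral>x. u n x * h x \<partial>m) - (\<integral>x. f x * h x \<partial>m)) \<longlonglongrightarrow> 0"
  proof (rule tendsto_rabs_zero_cancel, rule tendsto_sandwich[OF _ _ tendsto_const])
    have "\<bar>(\<integral>x. u n x * h x \<partial>m) - (\<integral>x. f x * h x \<partial>m)\<bar>
      \<le> L2_norm m (\<lambda>x. u n x - f x) * L2_norm m h" for n
    proof -
      have "(\<integral>x. u n x * h x \<partial>m) - (\<integral>x. f x * h x \<partial>m) = (\<integral>x. (u n x - f x) * h x \<partial>m)"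
        by (simp add: left_diff_distrib L2_mult_integrable[OF u[rule_format] h] L2_mult_integrable[OF f h])
      then show ?thesis using L2_Cauchy_Schwarz[OF L2_diff h] u f by metis
    qed
    then show "\<forall>\<^sub>F n in sequentially. \<bar>(\<integral>x. u n x * h x \<partial>m) - (\<integral>x. f x * h x \<partial>m)\<bar>
      \<le> L2_norm m (\<lambda>x. u n x - f x) * L2_norm m h" by simp
    have "(\<lambda>n. L2_norm m (\<lambda>x. u n x - f x) * L2_norm m h) \<longlonglongrightarrow> 0 * L2_norm m h"
      using assms by (intro tendsto_intros) (auto simp: L2_tendsto_def)
    then show "(\<lambda>n. L2_norm m (\<lambda>x. u n x - f x) * L2_norm m h) \<longlonglongrightarrow> 0" by simp
  qed simp
  then show "(\<lambda>n. \<integral>x. u n x * h x \<partial>m) \<longlonglongrightarrow> (\<integral>x. f x * h x \<partial>m)"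
    by (rule LIM_zero_cancel)
qed

text \<open>The inequality of measures is tested on the set where the density exceeds
  \<open>C\<close>, cut down to finite measure.\<close>

lemma (in sigma_finite_measure) RN_deriv_le_of_emeasure_le:
  assumes sets: "sets \<nu> = sets M"
    and le: "\<And>E. E \<in> sets M \<Longrightarrow> emeasure \<nu> E \<le> ennreal C * emeasure M E"
  shows "density M (RN_deriv M \<nu>) = \<nu>" "AE x in M. RN_deriv M \<nu> x \<le> ennreal C"
proof -
  have "absolutely_continuous M \<nu>"
    using le sets by (auto simp: absolutely_continuous_def null_sets_def) (metis le_zero_eq mult_zero_right)
  from density_RN_deriv[OF this sets] show \<nu>: "density M (RN_deriv M \<nu>) = \<nu>" .
  define r where "r = RN_deriv M \<nu>"
  have [measurable]: "r \<in> borel_measurable M" by (simp add: r_def)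
  obtain A :: "nat \<Rightarrow> 'a set" where A: "range A \<subseteq> sets M" "(\<Union>i. A i) = space M" "\<And>i. emeasure M (A i) \<noteq> \<infinity>"
    using sigma_finite by metis
  have [measurable]: "A i \<in> sets M" for i using A(1) by auto
  have "AE x in M. x \<in> A i \<longrightarrow> r x \<le> ennreal C" for i
  proof -
    define E where "E = {x\<in>space M. r x > ennreal C} \<inter> A i"
    have E [measurable]: "E \<in> sets M" unfolding E_def by measurable
    have "emeasure M E \<le> emeasure M (A i)" by (intro emeasure_mono) (auto simp: E_def)
    then have fin: "emeasure M E < \<infinity>" using A(3)[of i] by (auto simp: less_top le_less_trans)
    \<comment> \<open>Subtraction in \<open>ennreal\<close> truncates at 0. On \<open>E\<close> it
      is a genuine difference, while the difference of the integrals truncates to 0 by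
      \<open>le\<close>; hence the integrand vanishes almost everywhere.\<close>
    have "(\<integral>\<^sup>+ x. r x * indicator E x - ennreal C * indicator E x \<partial>M)
        = (\<integral>\<^sup>+ x. r x * indicator E x \<partial>M) - (\<integral>\<^sup>+ x. ennreal C * indicator E x \<partial>M)"
      using fin by (intro nn_integral_diff)
        (auto simp: nn_integral_cmult ennreal_mult_eq_top_iff E_def split: split_indicator)
    also have "(\<integral>\<^sup>+ x. r x * indicator E x \<partial>M) = emeasure \<nu> E"
      using E by (subst \<nu>[symmetric]) (simp add: emeasure_density r_def)
    also have "(\<integral>\<^sup>+ x. ennreal C * indicator E x \<partial>M) = ennreal C * emeasure M E"
      by (simp add: nn_integral_cmult)
    also have "emeasure \<nu> E - \<dots> = 0"
      using le[OF E] fin le_less_trans[OF le[OF E]] by (simp add: diff_eq_0_iff_ennreal ennreal_mult_less_top)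
    finally have "AE x in M. r x * indicator E x - ennreal C * indicator E x = 0"
      by (subst (asm) nn_integral_0_iff_AE) auto
    then show ?thesis
    proof (rule AE_mp, intro AE_I2 impI)
      fix x assume x: "x \<in> space M" "r x * indicator E x - ennreal C * indicator E x = 0" "x \<in> A i"
      show "r x \<le> ennreal C"
      proof (rule ccontr)
        assume "\<not> ?thesis"
        then have "x \<in> E" using x by (auto simp: E_def)
        then have "r x - ennreal C = 0" using x by simp
        with \<open>\<not> r x \<le> ennreal C\<close> show False by (auto simp: diff_eq_0_iff_ennreal)
      qed
    qed
  qed
  then have "AE x in M. \<forall>i. x \<in> A i \<longrightarrow> r x \<le> ennreal C"
    by (subst AE_all_countable) blast
  then show "AE x in M. RN_deriv M \<nu> x \<le> ennreal C"
    unfolding r_def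
  proof (rule AE_mp, intro AE_I2 impI)
    fix x assume "x \<in> space M" and le: "\<forall>i. x \<in> A i \<longrightarrow> RN_deriv M \<nu> x \<le> ennreal C"
    then obtain i where "x \<in> A i" using A(2) by blast
    then show "RN_deriv M \<nu> x \<le> ennreal C" using le by blast
  qed
qed

text \<open>The class of measures against which weak \<open>L2\<close> limits may be integrated. It
  covers the two normalized endpoint measures and the time average of a controlled plan.\<close>

locale dominated_prob = prob_space \<nu> + M: sigma_finite_measure M
  for \<nu> M :: "'a measure" +
  fixes C :: real
  assumes sets_eq [measurable_cong]: "sets \<nu> = sets M"
    and le: "E \<in> sets M \<Longrightarrow> emeasure \<nu> E \<le> ennreal C * emeasure M E"
begin

text \<open>A density bounded by \<open>C\<close> with total mass 1 has square integral at most
  \<open>C\<close>, even if \<open>M\<close> is infinite.\<close>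

lemma L2_density: "\<exists>h\<in>L2 M. (\<forall>x. 0 \<le> h x) \<and> \<nu> = density M (\<lambda>x. ennreal (h x))"
proof (rule bexI, intro conjI allI)
  define h where "h x = enn2real (RN_deriv M \<nu> x)" for x
  have [measurable]: "h \<in> borel_measurable M" unfolding h_def by measurable
  show h0: "0 \<le> h x" for x by (simp add: h_def)
  have RN: "density M (RN_deriv M \<nu>) = \<nu>" "AE x in M. RN_deriv M \<nu> x \<le> ennreal C"
    using M.RN_deriv_le_of_emeasure_le[OF sets_eq le] by auto
  have fin: "AE x in M. ennreal (h x) = RN_deriv M \<nu> x"
    using RN(2)
  proof eventually_elim
    case (elim x)
    then have "RN_deriv M \<nu> x < top" by (rule le_less_trans) simp
    then show ?case by (simp add: h_def)
  qed
  have "density M (\<lambda>x. ennreal (h x)) = density M (RN_deriv M \<nu>)"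
    using fin by (intro density_cong) auto
  then show \<nu>: "\<nu> = density M (\<lambda>x. ennreal (h x))" using RN(1) by simp
  have "(\<integral>\<^sup>+ x. ennreal ((h x)\<^sup>2) \<partial>M) \<le> (\<integral>\<^sup>+ x. ennreal C * ennreal (h x) \<partial>M)"
  proof (rule nn_integral_mono_AE)
    show "AE x in M. ennreal ((h x)\<^sup>2) \<le> ennreal C * ennreal (h x)"
      using RN(2) fin
    proof eventually_elim
      case (elim x)
      then have "ennreal (h x) * ennreal (h x) \<le> ennreal C * ennreal (h x)"
        by (intro mult_right_mono) auto
      then show ?case using h0[of x] by (simp add: power2_eq_square ennreal_mult)
    qed
  qed
  also have "\<dots> = ennreal C * (\<integral>\<^sup>+ x. ennreal (h x) \<partial>M)"
    by (simp add: nn_integral_cmult)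
  also have "(\<integral>\<^sup>+ x. ennreal (h x) \<partial>M) = emeasure (density M (\<lambda>x. ennreal (h x))) (space M)"
    by (subst emeasure_density) (auto intro!: nn_integral_cong)
  also have "\<dots> = 1"
    unfolding \<nu>[symmetric] using emeasure_space_1 by (simp add: sets_eq_imp_space_eq[OF sets_eq])
  finally have "(\<integral>\<^sup>+ x. ennreal ((h x)\<^sup>2) \<partial>M) \<le> ennreal C" by simp
  then have "(\<integral>\<^sup>+ x. ennreal ((h x)\<^sup>2) \<partial>M) < \<infinity>" by (rule le_less_trans) simp
  then show "h \<in> L2 M"
    by (auto simp: L2_def intro!: integrableI_nonneg)
qed

lemma integrable_L2:
  assumes "f \<in> L2 M"
  shows "integrable \<nu> f"
proof -
  obtain h where h: "h \<in> L2 M" "\<And>x. 0 \<le> h x" "\<nu> = density M (\<lambda>x. ennreal (h x))"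
    using L2_density by blast
  show ?thesis
    unfolding h(3) using assms h(1,2) L2_mult_integrable[OF h(1) assms]
    by (subst integrable_density) (auto simp: L2_def)
qed

lemma tendsto_integral_L2_weak:
  assumes "L2_weak_tendsto M u f"
  shows "(\<lambda>n. integral\<^sup>L \<nu> (u n)) \<longlonglongrightarrow> integral\<^sup>L \<nu> f"
proof -
  obtain h where h: "h \<in> L2 M" "\<And>x. 0 \<le> h x" "\<nu> = density M (\<lambda>x. ennreal (h x))"
    using L2_density by blast
  have "integral\<^sup>L \<nu> k = (\<integral>x. k x * h x \<partial>M)" if "k \<in> L2 M" for k
    unfolding h(3) using that h(1,2)
    by (subst integral_density) (auto simp: L2_def mult.commute)
  then show ?thesis
    using assms h(1) by (auto simp: L2_weak_tendsto_def)
qed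

end

section \<open>Time averages of transport plans\<close>

text \<open>\<open>ev t\<close> is unspecified for \<open>t\<close> outside the unit interval, so joint measurability in \<open>(t, \<gamma>)\<close>
  needs the time to be clamped.\<close>

definition clamp01 :: "real \<Rightarrow> real" where "clamp01 t = max 0 (min t 1)"

lemma clamp01_mem: "clamp01 t \<in> {0..1}" by (simp add: clamp01_def)

lemma clamp01_id: "t \<in> {0..1} \<Longrightarrow> clamp01 t = t" by (simp add: clamp01_def)

lemma continuous_ev_clamp01:
  fixes \<gamma> :: "'a::metric_space curve"
  shows "continuous_on UNIV (\<lambda>t. ev (clamp01 t) \<gamma>)"
proof -
  have "continuous_on {0..1} Abs_unit_interval"
    unfolding continuous_on_iff
    by (auto simp: dist_unit_interval.rep_eq Abs_unit_interval_inverse)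
  moreover have "continuous_on UNIV clamp01"
    unfolding clamp01_def by (intro continuous_intros)
  ultimately have "continuous_on UNIV (\<lambda>t. Abs_unit_interval (clamp01 t))"
    by (rule continuous_on_compose2) (use clamp01_mem in auto)
  moreover have "continuous_on UNIV (apply_bcontfun \<gamma>)"
    using apply_bcontfun[of \<gamma>] by (auto simp: bcontfun_def)
  ultimately show ?thesis
    unfolding ev_def using continuous_on_compose2 by blast
qed

text \<open>Continuity in time and measurability in the curve give joint measurability: rounding the
  time down to multiples of \<open>1 / Suc n\<close> leaves countably many time values, and the
  rounded maps converge pointwise.\<close>

lemma measurable_ev_clamp01:
  "(\<lambda>(t, \<gamma>). ev (clamp01 t) \<gamma>)
    \<in> borel_measurable (borel \<Otimes>\<^sub>M (borel :: 'a::{metric_space} curve measure))"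
proof (rule borel_measurable_LIMSEQ_metric)
  let ?r = "\<lambda>(n::nat) (t::real). \<lfloor>t * Suc n\<rfloor> / Suc n"
  let ?M = "borel \<Otimes>\<^sub>M (borel :: 'a curve measure)"
  have f: "(\<lambda>z. ev (clamp01 (real_of_int i / Suc n)) (snd z)) \<in> borel_measurable ?M" for i and n :: nat
    by (rule measurable_compose[OF measurable_snd borel_measurable_ev])
  have g: "(\<lambda>z. \<lfloor>fst z * real (Suc n)\<rfloor>) \<in> ?M \<rightarrow>\<^sub>M count_space UNIV" for n
    by (rule measurable_compose[OF measurable_fst]) measurable
  show "(\<lambda>z. ev (clamp01 (?r n (fst z))) (snd z)) \<in> borel_measurable ?M" for n
    by (rule measurable_compose_countable[OF f g])
  fix z :: "real \<times> 'a curve"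
  obtain t \<gamma> where z: "z = (t, \<gamma>)" by (cases z)
  have "(\<lambda>n. ?r n t) \<longlonglongrightarrow> t"
  proof (rule LIM_zero_cancel, rule tendsto_rabs_zero_cancel, rule tendsto_sandwich[OF _ _ tendsto_const])
    have "\<bar>?r n t - t\<bar> \<le> inverse (real (Suc n))" for n
    proof -
      have "\<bar>of_int \<lfloor>t * Suc n\<rfloor> - t * Suc n\<bar> \<le> 1" by linarith
      moreover have "?r n t - t = (of_int \<lfloor>t * Suc n\<rfloor> - t * Suc n) / Suc n"
        by (simp add: diff_divide_distrib)
      ultimately show ?thesis by (simp add: abs_divide divide_right_mono inverse_eq_divide del: of_nat_Suc)
    qed
    then show "\<forall>\<^sub>F n in sequentially. \<bar>?r n t - t\<bar> \<le> inverse (real (Suc n))" by simp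
    show "(\<lambda>n. inverse (real (Suc n))) \<longlonglongrightarrow> 0" by (rule LIMSEQ_inverse_real_of_nat)
  qed simp
  from continuous_on_tendsto_compose[OF continuous_ev_clamp01[of \<gamma>] this]
  show "(\<lambda>n. ev (clamp01 (?r n (fst z))) (snd z)) \<longlonglongrightarrow> (case z of (t, \<gamma>) \<Rightarrow> ev (clamp01 t) \<gamma>)"
    by (simp add: z)
qed

text \<open>The integral over \<open>t\<close> in \<open>[0, 1]\<close> of the laws of
  \<open>ev t\<close> under \<open>\<pi>\<close>, written as the image of a product measure so that
  Tonelli applies.\<close>

definition time_average :: "'a::polish_space curve measure \<Rightarrow> 'a measure" where
  "time_average \<pi> = distr (density lborel (indicator {0..1}) \<Otimes>\<^sub>M \<pi>) borel (\<lambda>(t, \<gamma>). ev (clamp01 t) \<gamma>)"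

lemma sets_time_average [simp, measurable_cong]: "sets (time_average \<pi>) = sets borel"
  by (simp add: time_average_def)

text \<open>Tonelli in both orders. Integrating over curves first brings in the density bounds at
  fixed times; integrating over time first brings in the upper gradient inequality on each
  geodesic.\<close>

lemma
  fixes \<pi> :: "'a::polish_space curve measure"
  assumes \<pi>: "prob_space \<pi>" "sets \<pi> = sets borel" and F [measurable]: "F \<in> borel_measurable borel"
  shows nn_integral_time_average:
      "(\<integral>\<^sup>+ x. F x \<partial>time_average \<pi>) = (\<integral>\<^sup>+ t\<in>{0..1}. (\<integral>\<^sup>+ x. F x \<partial>distr \<pi> borel (ev t)) \<partial>lborel)"
    and nn_integral_time_average':
      "(\<integral>\<^sup>+ x. F x \<partial>time_average \<pi>) = (\<integral>\<^sup>+ \<gamma>. (\<integral>\<^sup>+ t\<in>{0..1}. F (ev t \<gamma>) \<partial>lborel) \<partial>\<pi>)"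
    and borel_measurable_nn_integral_ev:
      "(\<lambda>\<gamma>. \<integral>\<^sup>+ t\<in>{0..1}. F (ev t \<gamma>) \<partial>lborel) \<in> borel_measurable \<pi>"
proof -
  let ?L = "density lborel (indicator {0..1::real})"
  let ?e = "\<lambda>(t, \<gamma>). ev (clamp01 t) \<gamma> :: 'a"
  interpret \<pi>: prob_space \<pi> by fact
  have [measurable_cong]: "sets \<pi> = sets borel" by fact
  interpret L: finite_measure ?L
    by standard (simp add: emeasure_density)
  interpret P: pair_sigma_finite ?L \<pi> ..
  have e [measurable]: "?e \<in> borel_measurable (?L \<Otimes>\<^sub>M \<pi>)"
    using measurable_ev_clamp01 by (simp cong: measurable_cong_sets sets_pair_measure_cong add: \<pi>(2))
  have [measurable]: "(\<lambda>z. F (?e z)) \<in> borel_measurable (?L \<Otimes>\<^sub>M \<pi>)" by measurable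
  have eq: "(\<integral>\<^sup>+ x. F x \<partial>time_average \<pi>) = (\<integral>\<^sup>+ z. F (?e z) \<partial>(?L \<Otimes>\<^sub>M \<pi>))"
    unfolding time_average_def by (rule nn_integral_distr) measurable
  have "(\<integral>\<^sup>+ z. F (?e z) \<partial>(?L \<Otimes>\<^sub>M \<pi>)) = (\<integral>\<^sup>+ t. (\<integral>\<^sup>+ \<gamma>. F (?e (t, \<gamma>)) \<partial>\<pi>) \<partial>?L)"
    by (rule \<pi>.nn_integral_fst[symmetric]) measurable
  also have "\<dots> = (\<integral>\<^sup>+ t. indicator {0..1} t * (\<integral>\<^sup>+ \<gamma>. F (?e (t, \<gamma>)) \<partial>\<pi>) \<partial>lborel)"
    by (rule nn_integral_density) measurable
  also have "\<dots> = (\<integral>\<^sup>+ t\<in>{0..1}. (\<integral>\<^sup>+ x. F x \<partial>distr \<pi> borel (ev t)) \<partial>lborel)"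
    by (intro nn_integral_cong) (auto simp: nn_integral_distr clamp01_id split: split_indicator)
  finally show "(\<integral>\<^sup>+ x. F x \<partial>time_average \<pi>) = \<dots>" using eq by simp
  have inner: "(\<integral>\<^sup>+ t. F (?e (t, \<gamma>)) \<partial>?L) = (\<integral>\<^sup>+ t\<in>{0..1}. F (ev t \<gamma>) \<partial>lborel)" for \<gamma>
  proof -
    have "(\<lambda>t. ev (clamp01 t) \<gamma>) \<in> borel_measurable borel"
      by (intro borel_measurable_continuous_onI continuous_ev_clamp01)
    then have "(\<lambda>t. F (?e (t, \<gamma>))) \<in> borel_measurable lborel" by simp
    then have "(\<integral>\<^sup>+ t. F (?e (t, \<gamma>)) \<partial>?L) = (\<integral>\<^sup>+ t. indicator {0..1} t * F (?e (t, \<gamma>)) \<partial>lborel)"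
      by (intro nn_integral_density) auto
    also have "\<dots> = (\<integral>\<^sup>+ t\<in>{0..1}. F (ev t \<gamma>) \<partial>lborel)"
      by (intro nn_integral_cong) (auto simp: clamp01_id split: split_indicator)
    finally show ?thesis .
  qed
  have "(\<integral>\<^sup>+ z. F (?e z) \<partial>(?L \<Otimes>\<^sub>M \<pi>)) = (\<integral>\<^sup>+ \<gamma>. (\<integral>\<^sup>+ t. F (?e (t, \<gamma>)) \<partial>?L) \<partial>\<pi>)"
    by (rule P.nn_integral_snd[symmetric]) measurable
  then show "(\<integral>\<^sup>+ x. F x \<partial>time_average \<pi>)
      = (\<integral>\<^sup>+ \<gamma>. (\<integral>\<^sup>+ t\<in>{0..1}. F (ev t \<gamma>) \<partial>lborel) \<partial>\<pi>)"
    unfolding inner using eq by simp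
  have "(\<lambda>(\<gamma>, t). F (?e (t, \<gamma>))) \<in> borel_measurable (\<pi> \<Otimes>\<^sub>M ?L)"
    using measurable_compose[OF measurable_pair_swap' \<open>(\<lambda>z. F (?e z)) \<in> _\<close>]
    by (simp add: case_prod_unfold)
  from L.borel_measurable_nn_integral[OF this]
  show "(\<lambda>\<gamma>. \<integral>\<^sup>+ t\<in>{0..1}. F (ev t \<gamma>) \<partial>lborel) \<in> borel_measurable \<pi>"
    unfolding inner .
qed

lemma prob_space_time_average:
  fixes \<pi> :: "'a::polish_space curve measure"
  assumes \<pi>: "prob_space \<pi>" "sets \<pi> = sets borel"
  shows "prob_space (time_average \<pi>)"
proof
  interpret prob_space \<pi> by fact
  have "emeasure (time_average \<pi>) (space (time_average \<pi>)) = (\<integral>\<^sup>+ x. 1 \<partial>time_average \<pi>)" by simp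
  also have "\<dots> = (\<integral>\<^sup>+ \<gamma>. (\<integral>\<^sup>+ t\<in>{0..1::real}. 1 \<partial>lborel) \<partial>\<pi>)"
    by (rule nn_integral_time_average'[OF \<pi>]) simp
  also have "\<dots> = 1" by (simp add: emeasure_space_1)
  finally show "emeasure (time_average \<pi>) (space (time_average \<pi>)) = 1" .
qed

section \<open>Domination of the endpoint measures and of the time average by
  \<open>m\<close>\<close>

context qcd_space
begin

lemma dominated_uniform:
  assumes A: "compact A" "emeasure m A > 0"
  shows "dominated_prob (uniform_measure m A) m (1 / measure m A)"
proof -
  interpret prob_space "uniform_measure m A" by (rule prob_space_uniform[OF A])
  have pos: "measure m A > 0" by (rule measure_compact_pos[OF A])
  have "emeasure m A = ennreal (measure m A)"
    using emeasure_compact[OF A(1)] by (simp add: emeasure_eq_ennreal_measure)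
  show ?thesis
  proof
    fix E assume E: "E \<in> sets m"
    have "emeasure (uniform_measure m A) E = emeasure m (A \<inter> E) / emeasure m A"
      using A E by (simp add: borel_compact)
    also have "\<dots> \<le> emeasure m E / emeasure m A"
      using A E by (intro divide_right_mono_ennreal emeasure_mono) auto
    also have "\<dots> = ennreal (1 / measure m A) * emeasure m E"
      using pos \<open>emeasure m A = _\<close>
      by (simp add: divide_ennreal_def inverse_ennreal mult.commute inverse_eq_divide)
    finally show "emeasure (uniform_measure m A) E \<le> ennreal (1 / measure m A) * emeasure m E" .
  qed simp
qed

text \<open>Each of the two bounds for controlled plans degenerates at one end of the time interval,
  so the first is used up to time \<open>1 / 2\<close> and the second afterwards. The endpoints
  themselves are a null set of times.\<close>

lemma dominated_time_average:
  assumes A: "compact A0" "compact A1" "emeasure m A0 > 0" "emeasure m A1 > 0"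
    and c: "c > 0" and \<pi>: "\<pi> \<in> controlled_plans c A0 A1"
  obtains C where "dominated_prob (time_average \<pi>) m C"
proof -
  have p: "prob_space \<pi>" "sets \<pi> = sets borel"
    using \<pi> by (auto simp: controlled_plans_def OptGeo_def borel_measure_def)
  interpret prob_space "time_average \<pi>" using p by (rule prob_space_time_average)
  define b0 where "b0 = (c * (1 / 2) * measure m A0 powr (1 / N)) powr (- N)"
  define b1 where "b1 = (c * (1 / 2) * measure m A1 powr (1 / N)) powr (- N)"
  have pos: "measure m A0 > 0" "measure m A1 > 0" using measure_compact_pos A by auto
  have mono: "(c * s * r powr (1 / N)) powr (- N) \<le> (c * (1 / 2) * r powr (1 / N)) powr (- N)"
    if "s \<ge> 1 / 2" "r > 0" for s r :: real
    using that c N by (intro powr_mono2' mult_right_mono mult_left_mono) auto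
  have le: "emeasure (distr \<pi> borel (ev t)) E \<le> ennreal (max b0 b1) * emeasure m E"
    if t: "0 < t" "t < 1" and E: "E \<in> sets borel" for t E
  proof (cases "t \<le> 1 / 2")
    case True
    have "emeasure (distr \<pi> borel (ev t)) E
        \<le> ennreal ((c * (1 - t) * measure m A0 powr (1 / N)) powr (- N)) * emeasure m E"
      using \<pi> t E by (simp add: controlled_plans_def)
    also have "\<dots> \<le> ennreal (max b0 b1) * emeasure m E"
      using mono[of "1 - t" "measure m A0"] True pos
      by (intro mult_right_mono ennreal_leI) (auto simp: b0_def)
    finally show ?thesis .
  next
    case False
    have "emeasure (distr \<pi> borel (ev t)) E
        \<le> ennreal ((c * t * measure m A1 powr (1 / N)) powr (- N)) * emeasure m E"
      using \<pi> t E by (simp add: controlled_plans_def)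
    also have "\<dots> \<le> ennreal (max b0 b1) * emeasure m E"
      using mono[of t "measure m A1"] False pos
      by (intro mult_right_mono ennreal_leI) (auto simp: b1_def)
    finally show ?thesis .
  qed
  have "dominated_prob (time_average \<pi>) m (max b0 b1)"
  proof
    fix E assume "E \<in> sets m"
    then have E: "E \<in> sets borel" by simp
    have "emeasure (time_average \<pi>) E = (\<integral>\<^sup>+ x. indicator E x \<partial>time_average \<pi>)"
      using E by simp
    also have "\<dots> = (\<integral>\<^sup>+ t\<in>{0..1}. (\<integral>\<^sup>+ x. indicator E x \<partial>distr \<pi> borel (ev t)) \<partial>lborel)"
      using p E by (intro nn_integral_time_average) auto
    also have "\<dots> \<le> (\<integral>\<^sup>+ t. ennreal (max b0 b1) * emeasure m E * indicator {0..1::real} t \<partial>lborel)"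
    proof (rule nn_integral_mono_AE)
      have "AE t in lborel. t \<noteq> (0::real) \<and> t \<noteq> 1"
        using AE_lborel_singleton[of "0::real"] AE_lborel_singleton[of "1::real"] by eventually_elim simp
      then show "AE t in lborel. (\<integral>\<^sup>+ x. indicator E x \<partial>distr \<pi> borel (ev t)) * indicator {0..1} t
          \<le> ennreal (max b0 b1) * emeasure m E * indicator {0..1} t"
      proof eventually_elim
        case (elim t)
        then show ?case using le[of t E] E by (auto split: split_indicator)
      qed
    qed
    also have "\<dots> = ennreal (max b0 b1) * emeasure m E"
      by (subst nn_integral_cmult_indicator) auto
    finally show "emeasure (time_average \<pi>) E \<le> ennreal (max b0 b1) * emeasure m E" .
  qed simp
  then show thesis by (rule that)
qed

end

section \<open>From Sobolev to Lipschitz\<close>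

lemma slope_nonneg: "0 \<le> slope f x"
  by (simp add: slope_def)

context qcd_space
begin

text \<open>The upper gradient inequality is integrated over the plan, geodesic lengths being at
  most \<open>d\<close>, and the resulting integral over curves and times is the integral against
  the time average.\<close>

lemma transport_slope_bound:
  assumes A: "compact A0" "compact A1"
    and d: "\<And>x y. x \<in> A0 \<Longrightarrow> y \<in> A1 \<Longrightarrow> dist x y \<le> d" "0 \<le> d"
    and \<pi>: "\<pi> \<in> OptGeo (uniform_measure m A0) (uniform_measure m A1)"
    and u: "L-lipschitz_on UNIV u"
      "integrable (uniform_measure m A0) u" "integrable (uniform_measure m A1) u"
    and s: "integrable (time_average \<pi>) (slope u)"
  shows "(\<integral>x. u x \<partial>uniform_measure m A0) - (\<integral>x. u x \<partial>uniform_measure m A1)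
    \<le> d * (\<integral>x. slope u x \<partial>time_average \<pi>)"
proof -
  have p: "prob_space \<pi>" and sets_\<pi> [measurable_cong]: "sets \<pi> = sets borel"
    and distr: "distr \<pi> borel (ev 0) = uniform_measure m A0" "distr \<pi> borel (ev 1) = uniform_measure m A1"
    using \<pi> by (auto simp: OptGeo_def borel_measure_def)
  have [measurable]: "u \<in> borel_measurable borel" "slope u \<in> borel_measurable borel"
    using borel_measurable_continuous_onI[OF lipschitz_on_continuous_on[OF u(1)]]
      borel_measurable_integrable[OF s] by (simp_all cong: measurable_cong_sets)
  have i: "integrable \<pi> (\<lambda>\<gamma>. u (ev 0 \<gamma>))" "integrable \<pi> (\<lambda>\<gamma>. u (ev 1 \<gamma>))"
    using u(2,3) unfolding distr[symmetric] by (simp_all add: integrable_distr_eq)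
  have "(\<integral>x. u x \<partial>uniform_measure m A0) - (\<integral>x. u x \<partial>uniform_measure m A1)
      = (\<integral>\<gamma>. u (ev 0 \<gamma>) - u (ev 1 \<gamma>) \<partial>\<pi>)"
    using i unfolding distr[symmetric] by (simp add: integral_distr)
  also have "\<dots> \<le> \<bar>\<integral>\<gamma>. u (ev 0 \<gamma>) - u (ev 1 \<gamma>) \<partial>\<pi>\<bar>" by simp
  also have "\<dots> \<le> d * (\<integral>x. slope u x \<partial>time_average \<pi>)"
  proof -
    have "ennreal \<bar>\<integral>\<gamma>. u (ev 0 \<gamma>) - u (ev 1 \<gamma>) \<partial>\<pi>\<bar>
        \<le> (\<integral>\<^sup>+ \<gamma>. ennreal \<bar>u (ev 0 \<gamma>) - u (ev 1 \<gamma>)\<bar> \<partial>\<pi>)"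
      using integral_norm_bound_ennreal[OF Bochner_Integration.integrable_diff[OF i]] by simp
    also have "\<dots> \<le> (\<integral>\<^sup>+ \<gamma>. ennreal d * (\<integral>\<^sup>+ t\<in>{0..1}. ennreal (slope u (ev t \<gamma>)) \<partial>lborel) \<partial>\<pi>)"
    proof (rule nn_integral_mono_AE)
      show "AE \<gamma> in \<pi>. ennreal \<bar>u (ev 0 \<gamma>) - u (ev 1 \<gamma>)\<bar>
          \<le> ennreal d * (\<integral>\<^sup>+ t\<in>{0..1}. ennreal (slope u (ev t \<gamma>)) \<partial>lborel)"
        using AE_OptGeo_uniform[OF A \<pi>]
      proof eventually_elim
        case (elim \<gamma>)
        then have "ennreal \<bar>u (ev 0 \<gamma>) - u (ev 1 \<gamma>)\<bar>
            \<le> ennreal (dist (ev 0 \<gamma>) (ev 1 \<gamma>)) * (\<integral>\<^sup>+ t\<in>{0..1}. ennreal (slope u (ev t \<gamma>)) \<partial>lborel)"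
          by (intro slope_upper_gradient[OF u(1)]) simp
        also have "\<dots> \<le> ennreal d * (\<integral>\<^sup>+ t\<in>{0..1}. ennreal (slope u (ev t \<gamma>)) \<partial>lborel)"
          using elim d by (intro mult_right_mono ennreal_leI) auto
        finally show ?case .
      qed
    qed
    also have "\<dots> \<le> ennreal d * (\<integral>\<^sup>+ \<gamma>. (\<integral>\<^sup>+ t\<in>{0..1}. ennreal (slope u (ev t \<gamma>)) \<partial>lborel) \<partial>\<pi>)"
      by (subst nn_integral_cmult[OF borel_measurable_nn_integral_ev[OF p sets_\<pi>]]) auto
    also have "(\<integral>\<^sup>+ \<gamma>. (\<integral>\<^sup>+ t\<in>{0..1}. ennreal (slope u (ev t \<gamma>)) \<partial>lborel) \<partial>\<pi>)
        = (\<integral>\<^sup>+ x. ennreal (slope u x) \<partial>time_average \<pi>)"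
      by (rule nn_integral_time_average'[OF p sets_\<pi>, symmetric]) measurable
    also have "\<dots> = ennreal (\<integral>x. slope u x \<partial>time_average \<pi>)"
      using s by (intro nn_integral_eq_integral) (auto simp: slope_nonneg)
    also have "ennreal d * \<dots> = ennreal (d * (\<integral>x. slope u x \<partial>time_average \<pi>))"
      using d(2) by (simp add: ennreal_mult')
    finally show ?thesis
      using d(2) by (subst (asm) ennreal_le_iff) (auto simp: slope_nonneg)
  qed
  finally show ?thesis .
qed

text \<open>The slope bound for an approximating sequence of Lipschitz functions passes to the
  limit, since all three measures have \<open>L2\<close> densities. Then \<open>f\<close> is
  compared with \<open>a\<close> and \<open>b\<close> on the endpoint sets, and the weak gradient
  with 1 along the geodesics.\<close>

lemma transport_Sobolev_bound:
  assumes A: "compact A0" "compact A1" "emeasure m A0 > 0" "emeasure m A1 > 0"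
    and d: "\<And>x y. x \<in> A0 \<Longrightarrow> y \<in> A1 \<Longrightarrow> dist x y \<le> d"
    and f: "f \<in> W12_loc m" and g: "is_wgrad_loc m f g" "AE x in m. g x \<le> 1"
    and a: "\<And>x. x \<in> A0 \<Longrightarrow> a \<le> f x" and b: "\<And>x. x \<in> A1 \<Longrightarrow> f x \<le> b"
  shows "a - b \<le> d"
proof -
  have "A0 \<noteq> {}" "A1 \<noteq> {}" using A(3,4) by auto
  then obtain x0 y0 where "x0 \<in> A0" "y0 \<in> A1" by auto
  then have d0: "0 \<le> d" using order_trans[OF zero_le_dist d] by blast
  obtain R where R: "\<And>x. x \<in> A0 \<Longrightarrow> dist x0 x \<le> R"
    using bounded_any_center[of A0 x0] compact_imp_bounded[OF A(1)] by auto
  \<comment> \<open>A transport geodesic starts within \<open>R\<close> of \<open>x0\<close> and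
    stays within \<open>d\<close> of its starting point, so it never leaves
    \<open>G\<close>.\<close>
  define G where "G = ball x0 (R + d + 1)"
  have "closure G \<subseteq> cball x0 (R + d + 1)"
    unfolding G_def by (intro closure_minimal) auto
  then have G: "open G" "compact (closure G)"
    using compact_Int_closed[OF compact_cball[of x0 "R + d + 1"], of "closure G"]
    by (auto simp: G_def inf.absorb2)
  have AG: "A0 \<subseteq> G" "A1 \<subseteq> G"
  proof -
    show "A0 \<subseteq> G" using R d0 by (force simp: G_def)
    have "dist x0 y < R + d + 1" if "y \<in> A1" for y
      using d[OF \<open>x0 \<in> A0\<close> that] R[OF \<open>x0 \<in> A0\<close>] by simp
    then show "A1 \<subseteq> G" by (auto simp: G_def)
  qed
  obtain fG where fG: "fG \<in> W12 m" "AE x in m. x \<in> G \<longrightarrow> f x = fG x"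
    using f G unfolding W12_loc_def by blast
  obtain gG where gG: "is_wgrad m fG gG" "AE x in m. x \<in> G \<longrightarrow> g x = gG x"
    using g(1) G fG unfolding is_wgrad_loc_def by blast
  obtain u where u: "\<And>n. u n \<in> Lip_bs" "L2_tendsto m u fG" "L2_weak_tendsto m (\<lambda>n. slope (u n)) gG"
    using gG(1) unfolding is_wgrad_def relaxed_slopes_def by blast
  obtain c where c: "c > 0" "controlled_plans c A0 A1 \<noteq> {}"
  proof -
    obtain c where "c > 0" and
      *: "\<forall>A0 A1. compact A0 \<and> compact A1 \<and> emeasure m A0 > 0 \<and> emeasure m A1 > 0 \<and>
        (\<forall>x\<in>A0. \<forall>y\<in>A1. dist x y \<le> d) \<longrightarrow> controlled_plans c A0 A1 \<noteq> {}"
      by (rule controlled_plans_nonempty)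
    have "controlled_plans c A0 A1 \<noteq> {}"
      using A d by (intro *[THEN spec, THEN spec, THEN mp] conjI ballI)
    with \<open>c > 0\<close> show thesis by (rule that)
  qed
  then obtain \<pi> where \<pi>: "\<pi> \<in> controlled_plans c A0 A1" by blast
  then have opt: "\<pi> \<in> OptGeo (uniform_measure m A0) (uniform_measure m A1)"
    by (simp add: controlled_plans_def)
  then have p: "prob_space \<pi>" "sets \<pi> = sets borel"
    by (auto simp: OptGeo_def borel_measure_def)
  obtain C where "dominated_prob (time_average \<pi>) m C"
    using dominated_time_average[OF A c(1) \<pi>] by blast
  then interpret T: dominated_prob "time_average \<pi>" m C .
  interpret U0: dominated_prob "uniform_measure m A0" m "1 / measure m A0"
    by (rule dominated_uniform[OF A(1,3)])
  interpret U1: dominated_prob "uniform_measure m A1" m "1 / measure m A1"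
    by (rule dominated_uniform[OF A(2,4)])
  note weak = L2_tendsto_imp_weak[OF u(2)]
  have L2: "u n \<in> L2 m" "slope (u n) \<in> L2 m" "fG \<in> L2 m" "gG \<in> L2 m" for n
    using u by (auto simp: L2_tendsto_def L2_weak_tendsto_def)
  have le: "(\<integral>x. fG x \<partial>uniform_measure m A0) - (\<integral>x. fG x \<partial>uniform_measure m A1)
      \<le> d * (\<integral>x. gG x \<partial>time_average \<pi>)"
  proof (rule LIMSEQ_le)
    show "(\<lambda>n. (\<integral>x. u n x \<partial>uniform_measure m A0) - (\<integral>x. u n x \<partial>uniform_measure m A1))
        \<longlonglongrightarrow> (\<integral>x. fG x \<partial>uniform_measure m A0) - (\<integral>x. fG x \<partial>uniform_measure m A1)"
      \<comment> \<open>The functions converge strongly, hence weakly, while the slopes below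
        converge only weakly.\<close>
      by (intro tendsto_diff U0.tendsto_integral_L2_weak U1.tendsto_integral_L2_weak weak)
    show "(\<lambda>n. d * (\<integral>x. slope (u n) x \<partial>time_average \<pi>)) \<longlonglongrightarrow> d * (\<integral>x. gG x \<partial>time_average \<pi>)"
      by (intro tendsto_mult_left T.tendsto_integral_L2_weak u(3))
    have "(\<integral>x. u n x \<partial>uniform_measure m A0) - (\<integral>x. u n x \<partial>uniform_measure m A1)
        \<le> d * (\<integral>x. slope (u n) x \<partial>time_average \<pi>)" for n
    proof -
      obtain L where "L-lipschitz_on UNIV (u n)" using u(1)[of n] by (auto simp: Lip_bs_def)
      then show ?thesis
        using A(1,2) d d0 opt L2
        by (intro transport_slope_bound U0.integrable_L2 U1.integrable_L2 T.integrable_L2)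
    qed
    then show "\<exists>n0. \<forall>n\<ge>n0. (\<integral>x. u n x \<partial>uniform_measure m A0) - (\<integral>x. u n x \<partial>uniform_measure m A1)
        \<le> d * (\<integral>x. slope (u n) x \<partial>time_average \<pi>)" by blast
  qed
  have "a = (\<integral>x. a \<partial>uniform_measure m A0)" using U0.prob_space by simp
  also have "\<dots> \<le> (\<integral>x. fG x \<partial>uniform_measure m A0)"
  proof (rule integral_mono_AE)
    show "AE x in uniform_measure m A0. a \<le> fG x"
    proof (rule AE_uniform_measureI)
      show "AE x in m. x \<in> A0 \<longrightarrow> a \<le> fG x"
        using fG(2)
      proof eventually_elim
        case (elim x)
        then show ?case using a[of x] AG by auto
      qed
    qed (use A in \<open>simp add: borel_compact\<close>)
  qed (use U0.integrable_L2 L2 in simp_all)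
  finally have a': "a \<le> (\<integral>x. fG x \<partial>uniform_measure m A0)" .
  have "(\<integral>x. fG x \<partial>uniform_measure m A1) \<le> (\<integral>x. b \<partial>uniform_measure m A1)"
  proof (rule integral_mono_AE)
    show "AE x in uniform_measure m A1. fG x \<le> b"
    proof (rule AE_uniform_measureI)
      show "AE x in m. x \<in> A1 \<longrightarrow> fG x \<le> b"
        using fG(2)
      proof eventually_elim
        case (elim x)
        then show ?case using b[of x] AG by auto
      qed
    qed (use A in \<open>simp add: borel_compact\<close>)
  qed (use U1.integrable_L2 L2 in simp_all)
  then have b': "(\<integral>x. fG x \<partial>uniform_measure m A1) \<le> b" using U1.prob_space by simp
  have "(\<integral>x. gG x \<partial>time_average \<pi>) \<le> (\<integral>x. 1 \<partial>time_average \<pi>)"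
  proof (rule integral_mono_AE)
    \<comment> \<open>Domination carries the bound on the weak gradient from \<open>m\<close>-almost
      every point of \<open>G\<close> to almost every point for the time average, which is
      concentrated on \<open>G\<close>.\<close>
    have "absolutely_continuous m (time_average \<pi>)"
      unfolding absolutely_continuous_def null_sets_def
      using T.le by auto (metis le_zero_eq mult_zero_right sets_m)
    moreover have "AE x in m. x \<in> G \<longrightarrow> gG x \<le> 1"
      using gG(2) g(2) by eventually_elim auto
    ultimately have "AE x in time_average \<pi>. x \<in> G \<longrightarrow> gG x \<le> 1"
      by (intro absolutely_continuous_AE[of "time_average \<pi>" m]) simp_all
    moreover have "AE x in time_average \<pi>. x \<in> G"
    proof -
      have "emeasure (time_average \<pi>) (- G) = (\<integral>\<^sup>+ x. indicator (- G) x \<partial>time_average \<pi>)"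
        using G by simp
      also have "\<dots> = (\<integral>\<^sup>+ \<gamma>. (\<integral>\<^sup>+ t\<in>{0..1}. indicator (- G) (ev t \<gamma>) \<partial>lborel) \<partial>\<pi>)"
        using p G by (intro nn_integral_time_average') auto
      also have "\<dots> = (\<integral>\<^sup>+ \<gamma>. 0 \<partial>\<pi>)"
      proof (rule nn_integral_cong_AE)
        show "AE \<gamma> in \<pi>. (\<integral>\<^sup>+ t\<in>{0..1}. indicator (- G) (ev t \<gamma>) \<partial>lborel) = 0"
          using AE_OptGeo_uniform[OF A(1,2) opt]
        proof eventually_elim
          case (elim \<gamma>)
          have "ev t \<gamma> \<in> G" if t: "t \<in> {0..1}" for t
          proof -
            have "dist (ev 0 \<gamma>) (ev t \<gamma>) = t * dist (ev 0 \<gamma>) (ev 1 \<gamma>)"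
              using GeoD[of \<gamma> 0 t] elim t by simp
            also have "\<dots> \<le> 1 * d" using elim t d by (intro mult_mono) auto
            finally show ?thesis
              using dist_triangle[of x0 "ev t \<gamma>" "ev 0 \<gamma>"] R[of "ev 0 \<gamma>"] elim by (simp add: G_def)
          qed
          then have 0: "indicator (- G) (ev t \<gamma>) * indicator {0..1} t = (0::ennreal)" for t
            by (auto split: split_indicator)
          show ?case unfolding 0 by simp
        qed
      qed
      finally have "- G \<in> null_sets (time_average \<pi>)" using G by (auto simp: null_sets_def)
      then have "AE x in time_average \<pi>. x \<notin> - G" by (rule AE_not_in)
      then show ?thesis by simp
    qed
    ultimately show "AE x in time_average \<pi>. gG x \<le> 1" by eventually_elim auto
  qed (use T.integrable_L2 L2 in simp_all)
  also have "\<dots> = 1" using T.prob_space by simp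
  finally have "d * (\<integral>x. gG x \<partial>time_average \<pi>) \<le> d * 1"
    using d0 by (intro mult_left_mono)
  with le a' b' show ?thesis by linarith
qed

lemma Sobolev_to_Lipschitz:
  assumes f: "f \<in> W12_loc m" and g: "is_wgrad_loc m f g" "AE x in m. g x \<le> 1"
  shows "\<exists>fhat. 1-lipschitz_on UNIV fhat \<and> (AE x in m. f x = fhat x)"
proof -
  have [measurable]: "f \<in> borel_measurable borel"
    using f by (simp add: W12_loc_def cong: measurable_cong_sets)
  obtain B :: "'a set set" where B: "countable B" "topological_basis B"
    using ex_countable_basis by blast
  define above where "above U q = {x \<in> U. q < f x}" for U q
  define below where "below U q = {x \<in> U. f x < q}" for U q
  have sets: "above U q \<in> sets borel" "below U q \<in> sets borel" if "U \<in> B" for U q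
  proof -
    have [measurable]: "U \<in> sets borel" using topological_basis_open[OF B(2) that] by simp
    show "above U q \<in> sets borel" "below U q \<in> sets borel"
      unfolding above_def below_def by measurable
  qed
  \<comment> \<open>Bad points lie in one of countably many null sets. At a good point,
    \<open>f\<close> takes values above any rational below \<open>f x\<close>, and below any
    rational above \<open>f x\<close>, on sets of positive measure in every basic
    neighbourhood.\<close>
  define good where "good x \<longleftrightarrow> (\<forall>U\<in>B. \<forall>q\<in>\<rat>.
    (x \<in> above U q \<longrightarrow> emeasure m (above U q) > 0) \<and> (x \<in> below U q \<longrightarrow> emeasure m (below U q) > 0))" for x
  have null: "AE x in m. x \<in> E \<longrightarrow> emeasure m E > 0" if "E \<in> sets borel" for E
  proof (cases "emeasure m E = 0")
    case True
    then have "E \<in> null_sets m" using that by (simp add: null_sets_def)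
    from AE_not_in[OF this] show ?thesis by eventually_elim simp
  qed (simp add: zero_less_iff_neq_zero)
  have AE_good: "AE x in m. good x"
    unfolding good_def AE_ball_countable[OF B(1)] AE_ball_countable[OF countable_rat]
    by (intro ballI AE_conjI null sets)
  have le: "f z - f w \<le> dist z w" if "good z" "good w" for z w
  proof (rule field_le_epsilon)
    fix e :: real assume "e > 0"
    \<comment> \<open>The error is spent four times: twice on the radii of the neighbourhoods, once
      each on the thresholds \<open>a\<close> and \<open>b\<close>.\<close>
    define r where "r = e / 4"
    have r: "r > 0" using \<open>e > 0\<close> by (simp add: r_def)
    obtain U where U: "U \<in> B" "z \<in> U" "U \<subseteq> ball z r"
      using topological_basisE[OF B(2) open_ball centre_in_ball[THEN iffD2, OF r]] by blast
    obtain V where V: "V \<in> B" "w \<in> V" "V \<subseteq> ball w r"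
      using topological_basisE[OF B(2) open_ball centre_in_ball[THEN iffD2, OF r]] by blast
    obtain a where a: "a \<in> \<rat>" "f z - r < a" "a < f z"
      using Rats_dense_in_real[of "f z - r" "f z"] r by auto
    obtain b where b: "b \<in> \<rat>" "f w < b" "b < f w + r"
      using Rats_dense_in_real[of "f w" "f w + r"] r by auto
    have "z \<in> above U a" "w \<in> below V b"
      using U(2) V(2) a(3) b(2) by (simp_all add: above_def below_def)
    then have pos: "emeasure m (above U a) > 0" "emeasure m (below V b) > 0"
      using that U(1) V(1) a(1) b(1) unfolding good_def by blast+
    obtain A0 where A0: "compact A0" "A0 \<subseteq> above U a" "emeasure m A0 > 0"
      using inner_compact[OF sets(1)[OF U(1)] pos(1)] by blast
    obtain A1 where A1: "compact A1" "A1 \<subseteq> below V b" "emeasure m A1 > 0"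
      using inner_compact[OF sets(2)[OF V(1)] pos(2)] by blast
    have "a - b \<le> dist z w + 2 * r"
    proof (rule transport_Sobolev_bound[OF A0(1) A1(1) A0(3) A1(3) _ f g])
      fix x y assume "x \<in> A0" "y \<in> A1"
      then have "dist z x < r" "dist w y < r"
        using A0(2) A1(2) U(3) V(3) by (auto simp: above_def below_def)
      then show "dist x y \<le> dist z w + 2 * r"
        using dist_triangle[of x y z] dist_triangle[of z y w] by (simp add: dist_commute)
    qed (use A0(2) A1(2) in \<open>auto simp: above_def below_def intro: less_imp_le\<close>)
    then show "f z - f w \<le> dist z w + e"
      using a b by (simp add: r_def)
  qed
  have "1-lipschitz_on (Collect good) f"
  proof (rule lipschitz_onI)
    fix z w assume "z \<in> Collect good" "w \<in> Collect good"
    then show "dist (f z) (f w) \<le> 1 * dist z w"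
      using le[of z w] le[of w z] by (auto simp: dist_real_def dist_commute)
  qed simp
  then obtain fhat where fhat: "1-lipschitz_on (closure (Collect good)) fhat" "\<forall>x\<in>Collect good. fhat x = f x"
    using lipschitz_extend_closure by blast
  \<comment> \<open>The complement of the closure is open and null, hence empty because
    \<open>m\<close> has full support.\<close>
  have "closure (Collect good) = UNIV"
  proof (rule ccontr)
    assume "closure (Collect good) \<noteq> UNIV"
    then obtain x where x: "x \<in> - closure (Collect good)" by auto
    have "AE x in m. x \<notin> - closure (Collect good)"
      using AE_good
    proof eventually_elim
      case (elim x)
      then show ?case using closure_subset[of "Collect good"] by auto
    qed
    then have "- closure (Collect good) \<in> null_sets m"
      by (subst AE_iff_null_sets) auto
    then show False using emeasure_open_pos[OF _ x] by (simp add: null_sets_def open_closed)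
  qed
  with fhat AE_good show ?thesis
    by (intro exI[of _ fhat]) (auto elim!: eventually_mono)
qed

end

theorem proposition4p4:
  fixes m :: "'a::polish_space measure"
    and Q K N :: real
    and f g :: "'a \<Rightarrow> real"
  assumes "Q \<ge> 1" and "N > 1"
    and "geodesic_space TYPE('a)"
    and "monge_space m"
    and "QCD Q K N m"
    and "infinitesimally_hilbertian m"
    and "f \<in> W12_loc m \<inter> L_infty m"
    and "is_wgrad_loc m f g"
    and "AE x in m. g x \<le> 1"
  shows "\<exists>fhat :: 'a \<Rightarrow> real. 1-lipschitz_on UNIV fhat \<and> (AE x in m. f x = fhat x)"
proof -
  interpret qcd_space m Q K N using assms by unfold_locales
  show ?thesis using assms by (intro Sobolev_to_Lipschitz) auto
qed

end
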